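(* Let $\sigma>0$ and $\lambda\in\mathcal D$ with equilibrium $\theta$ and $q=-\lambda'$. (i) (Subquadratic.) If $q(\theta+y)=o(y^2)$ as $|y|\to\infty$, then $\mathcal N_{1/2}(T,x)<\infty$ for every $T>0$ and every $x\in\mathbb R$. (ii) (Supercritical.) If $\lambda$ is supercritical (in the windowed sense defined in the context), then $\mathcal N_{1/2}(T,x)=\infty$ for every $T>0$ and every $x\in\mathbb R$.
   Context: Class $\mathcal D$: all $\lambda\in C^1(\mathbb R)$ that are strictly decreasing with $\lambda(\theta)=0$ for some (unique) $\theta\in\mathbb R$, called the equilibrium. For $R>0$ set $q_*^{\pm}(R):=\inf\{q(y):|\pm(y-\theta)-R|\le1\}$. A drift $\lambda\in\mathcal D$ is supercritical if there is a sequence $R_n\uparrow\infty$ such that $q_*^+(R_n)/R_n^2\to\infty$ or $q_*^-(R_n)/R_n^2\to\infty$. For $\lambda\in\mathcal D$ the SDE $\mathrm dX_t=\lambda(X_t)\,\mathrm dt+\sigma\,\mathrm dW_t$, $X_0=x$ ($W$ a standard Brownian motion) has a unique non-explosive strong solution, and $$\mathcal N_{1/2}(T,x):=\mathbb E_x\Big[\exp\Big\{\frac12\int_0^T\frac{\lambda(X_s)^2}{\sigma^2}\,\mathrm ds\Big\}\Big]\in[1,\infty].$$ *)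

theory Defs
  imports "HOL-Probability.Probability" "HOL-Library.Landau_Symbols"
begin

section \<open>Drifts\<close>

definition drift_class :: "(real \<Rightarrow> real) set"  where
  "drift_class = {b. b C1_differentiable_on UNIV \<and> strict_antimono_on UNIV b \<and> (\<exists>\<theta>. b \<theta> = 0)}"

definition equilibrium :: "(real \<Rightarrow> real) \<Rightarrow> real" where
  "equilibrium b = (THE \<theta>. b \<theta> = 0)"

lemma equilibrium_eqI:
  assumes "b \<in> drift_class" "b \<theta> = 0"
  shows "equilibrium b = \<theta>"
  unfolding equilibrium_def
proof (rule the_equality)
  fix \<theta>' assume "b \<theta>' = 0"
  moreover have "strict_antimono_on UNIV b"
    using assms(1) by (simp add: drift_class_def)
  ultimately show "\<theta>' = \<theta>"
    using assms(2) by (metis monotone_onD UNIV_I less_irrefl linorder_neqE)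
qed (rule assms(2))

definition neg_slope :: "(real \<Rightarrow> real) \<Rightarrow> real \<Rightarrow> real" where
  "neg_slope b y = - deriv b y"

text \<open>For a drift in \<^const>\<open>drift_class\<close> the two infima below are genuine: the window is
  nonempty and \<^term>\<open>neg_slope b\<close> is nonnegative.\<close>

definition window_inf_pos :: "(real \<Rightarrow> real) \<Rightarrow> real \<Rightarrow> real" where
  "window_inf_pos b R = (INF y\<in>{y. \<bar>(y - equilibrium b) - R\<bar> \<le> 1}. neg_slope b y)"

definition window_inf_neg :: "(real \<Rightarrow> real) \<Rightarrow> real \<Rightarrow> real" where
  "window_inf_neg b R = (INF y\<in>{y. \<bar>- (y - equilibrium b) - R\<bar> \<le> 1}. neg_slope b y)"

definition supercritical :: "(real \<Rightarrow> real) \<Rightarrow> bool" where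
  "supercritical b \<longleftrightarrow>
     (\<exists>R :: nat \<Rightarrow> real. (\<forall>n. R n > 0) \<and> incseq R \<and> filterlim R at_top sequentially \<and>
        (filterlim (\<lambda>n. window_inf_pos b (R n) / (R n)\<^sup>2) at_top sequentially \<or>
         filterlim (\<lambda>n. window_inf_neg b (R n) / (R n)\<^sup>2) at_top sequentially))"

section \<open>Brownian motion and strong solutions\<close>

text \<open>Processes are indexed by real times; only their values at times \<open>t \<ge> 0\<close> matter.\<close>

definition standard_brownian_motion :: "'a measure \<Rightarrow> (real \<Rightarrow> 'a \<Rightarrow> real) \<Rightarrow> bool" where
  "standard_brownian_motion M W \<longleftrightarrow>
     prob_space M \<and>
     (\<forall>t\<ge>0. W t \<in> borel_measurable M) \<and>
     (AE \<omega> in M. W 0 \<omega> = 0) \<and>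
     (\<forall>(n::nat) t :: nat \<Rightarrow> real. 0 \<le> t 0 \<and> incseq t \<longrightarrow>
        prob_space.indep_vars M (\<lambda>_. borel) (\<lambda>i \<omega>. W (t (Suc i)) \<omega> - W (t i) \<omega>) {..<n}) \<and>
     (\<forall>s t. 0 \<le> s \<and> s < t \<longrightarrow>
        distributed M lborel (\<lambda>\<omega>. W t \<omega> - W s \<omega>) (normal_density 0 (sqrt (t - s)))) \<and>
     (AE \<omega> in M. continuous_on {0..} (\<lambda>t. W t \<omega>))"

text \<open>The filtration generated by \<open>W\<close>, augmented by the null sets of \<open>M\<close>.\<close>

definition augmented_filtration ::
  "'a measure \<Rightarrow> (real \<Rightarrow> 'a \<Rightarrow> real) \<Rightarrow> real \<Rightarrow> 'a measure" where
  "augmented_filtration M W t =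
     sigma (space M)
       ((\<Union>s\<in>{0..t}. {W s -` B \<inter> space M | B. B \<in> sets borel}) \<union> null_sets M)"

text \<open>Strong solutions of \<open>dX = b(X) dt + \<sigma> dW\<close>, \<open>X\<^sub>0 = x\<close>, on the given probability space and
  for the given Brownian motion. As the noise is additive, the stochastic integral of the constant
  \<open>\<sigma>\<close> is \<open>\<sigma> W\<^sub>t\<close>. Solutions are real-valued at all times, hence non-explosive.\<close>

definition strong_solution ::
  "'a measure \<Rightarrow> (real \<Rightarrow> 'a \<Rightarrow> real) \<Rightarrow> (real \<Rightarrow> real) \<Rightarrow> real \<Rightarrow> real \<Rightarrow>
   (real \<Rightarrow> 'a \<Rightarrow> real) \<Rightarrow> bool" where
  "strong_solution M W b \<sigma> x X \<longleftrightarrow>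
     (\<forall>t\<ge>0. X t \<in> borel_measurable (augmented_filtration M W t)) \<and>
     (AE \<omega> in M. continuous_on {0..} (\<lambda>t. X t \<omega>)) \<and>
     (AE \<omega> in M. X 0 \<omega> = x) \<and>
     (AE \<omega> in M. \<forall>t\<ge>0. X t \<omega> = x + (LBINT s:{0..t}. b (X s \<omega>)) + \<sigma> * W t \<omega>)"

text \<open>The starting point \<open>x\<close> enters only through the solution \<open>X\<close>.\<close>

definition novikov_half ::
  "'a measure \<Rightarrow> (real \<Rightarrow> real) \<Rightarrow> real \<Rightarrow> (real \<Rightarrow> 'a \<Rightarrow> real) \<Rightarrow> real \<Rightarrow> ennreal" where
  "novikov_half M b \<sigma> X T =
     (\<integral>\<^sup>+\<omega>. ennreal (exp (1 / 2 * (LBINT s:{0..T}. (b (X s \<omega>))\<^sup>2 / \<sigma>\<^sup>2))) \<partial>M)"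

end

theory Submission
  imports Defs
begin

text \<open>Along the Euler scheme \<open>Y\<close> with step \<open>h\<close>, an exact Gaussian shift in every step turns
  \<open>E[exp (1/2 \<Sum> h b(Y\<^sub>i)\<^sup>2 / \<sigma>\<^sup>2)]\<close> into \<open>E[exp (\<Sum> b(B\<^sub>i) (B\<^sub>i\<^sub>+\<^sub>1 - B\<^sub>i) / \<sigma>\<^sup>2)]\<close> with
  \<open>B = x + \<sigma> W\<close>. If \<open>L' = b\<close> and \<open>q = - b'\<close>, Taylor's formula writes the summands as
  \<open>L(B\<^sub>i\<^sub>+\<^sub>1) - L(B\<^sub>i) + q(v\<^sub>i) (B\<^sub>i\<^sub>+\<^sub>1 - B\<^sub>i)\<^sup>2 / 2\<close>. These two steps replace Girsanov's theorem
  and Ito's formula. Since the noise is additive and \<open>b\<close> is locally Lipschitz, the Euler scheme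
  converges to the solution path by path, uniformly on compact time intervals.

  The potential \<open>L\<close> is bounded above, so a subquadratic \<open>q\<close> leaves only \<open>E[exp (\<epsilon> \<integral> B\<^sup>2)]\<close> to
  bound, which is finite for small \<open>\<epsilon>\<close>; Fatou's lemma gives finiteness. If \<open>q \<ge> \<kappa>\<close> within distance \<open>1\<close> of a point \<open>a\<close>, then the
  paths that move to \<open>a\<close>, stay there for a third of the time and return to \<open>x\<close> have probability at
  least \<open>exp (- C (1 + (a - x)\<^sup>2))\<close> and contribute a factor \<open>exp (\<kappa> T / 12)\<close>; the reverse Fatou lemma
  transfers this lower bound to the solution. It is enough to treat small \<open>T\<close>, for which the
  oscillation of \<open>\<sigma> W\<close> is at most \<open>1\<close> with high probability.\<close>

section \<open>Walks with Gaussian steps\<close>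

text \<open>Displacement \<open>c i\<close> and noise \<open>z i\<close> are kept apart, so that one
  recursion covers the Euler scheme (\<open>c\<close> the drift times the step), the plain random
  walk (\<open>c = 0\<close>) and a random walk carried along a deterministic curve.\<close>

primrec walk :: "(nat \<Rightarrow> real \<Rightarrow> real) \<Rightarrow> real \<Rightarrow> (nat \<Rightarrow> real) \<Rightarrow> nat \<Rightarrow> real" where
  "walk c x z 0 = x"
| "walk c x z (Suc i) = walk c x z i + c i (walk c x z i) + z i"

lemma walk_cong: "(\<And>j. j < i \<Longrightarrow> z j = z' j) \<Longrightarrow> walk c x z i = walk c x z' i"
  by (induction i) auto

lemma walk_zero: "walk (\<lambda>_ _. 0) x z i = x + (\<Sum>j<i. z j)"
  by (induction i) auto

lemma walk_deterministic:
  "walk (\<lambda>i _. m (Suc i) - m i) (m 0) z i = m i + (\<Sum>j<i. z j)"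
  by (induction i) auto

lemma measurable_walk:
  assumes "\<And>i. c i \<in> borel_measurable borel" "\<And>j. j < i \<Longrightarrow> (\<lambda>\<omega>. Z \<omega> j) \<in> borel_measurable A"
  shows "(\<lambda>\<omega>. walk c x (Z \<omega>) i) \<in> borel_measurable A"
  using assms(2)
proof (induction i)
  case (Suc i)
  then have [measurable]: "(\<lambda>\<omega>. walk c x (Z \<omega>) i) \<in> borel_measurable A"
      "(\<lambda>\<omega>. Z \<omega> i) \<in> borel_measurable A" by auto
  note assms(1)[measurable]
  show ?case by simp
qed simp

section \<open>One-step Gaussian integrals and their iteration under a product measure\<close>

abbreviation gauss :: "real \<Rightarrow> real measure" where
  "gauss s \<equiv> density lborel (normal_density 0 s)"

text \<open>Multiplying the density by the exponential of a square gives \<open>1 / sqrt r\<close>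
  times another centred normal density, of variance \<open>s\<^sup>2 / r\<close> with
  \<open>r = 1 - 2 * a * s\<^sup>2\<close>. The coefficient \<open>a\<close> may be negative, which
  the Chernoff bound uses.\<close>

lemma nn_integral_gauss_exp_square:
  assumes "s > 0" "2 * a * s\<^sup>2 < 1"
  shows "(\<integral>\<^sup>+u. ennreal (exp (a * u\<^sup>2)) \<partial>gauss s) = ennreal (1 / sqrt (1 - 2 * a * s\<^sup>2))"
proof -
  define r where "r = 1 - 2 * a * s\<^sup>2"
  have r: "r > 0" using assms by (simp add: r_def)
  define t where "t = s / sqrt r"
  have t: "t > 0" using assms r by (simp add: t_def)
  have tt: "t\<^sup>2 = s\<^sup>2 / r" using r by (simp add: t_def power_divide)
  have eq: "normal_density 0 s u * exp (a * u\<^sup>2) = 1 / sqrt r * normal_density 0 t u" for u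
  proof -
    have "- (u\<^sup>2) / (2 * s\<^sup>2) + a * u\<^sup>2 = - (u\<^sup>2) / (2 * t\<^sup>2)"
      using assms r unfolding tt by (simp add: r_def field_simps)
    moreover have "sqrt (2 * pi * t\<^sup>2) = sqrt (2 * pi * s\<^sup>2) / sqrt r"
      unfolding tt by (simp add: real_sqrt_divide)
    ultimately show ?thesis
      using r by (simp add: normal_density_def exp_add[symmetric] field_simps)
  qed
  have "(\<integral>\<^sup>+u. ennreal (exp (a * u\<^sup>2)) \<partial>gauss s)
      = (\<integral>\<^sup>+u. ennreal (normal_density 0 s u * exp (a * u\<^sup>2)) \<partial>lborel)"
    by (subst nn_integral_density) (auto simp: ennreal_mult)
  also have "\<dots> = (\<integral>\<^sup>+u. ennreal (1 / sqrt r) * ennreal (normal_density 0 t u) \<partial>lborel)"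
    unfolding eq by (subst ennreal_mult) (use r in auto)
  also have "\<dots> = ennreal (1 / sqrt r) * (\<integral>\<^sup>+u. ennreal (normal_density 0 t u) \<partial>lborel)"
    by (rule nn_integral_cmult) simp
  also have "(\<integral>\<^sup>+u. ennreal (normal_density 0 t u) \<partial>lborel) = 1"
    using prob_space.emeasure_space_1[OF prob_space_normal_density[OF t, of 0]]
    by (simp add: emeasure_density)
  finally show ?thesis by (simp add: r_def)
qed

text \<open>The Cameron-Martin formula on the real line: completing the square shows that
  translation by \<open>d\<close> multiplies the normal density by the displayed
  exponential.\<close>

lemma nn_integral_gauss_shift:
  assumes "s > 0" and [measurable]: "f \<in> borel_measurable borel"
  shows "(\<integral>\<^sup>+u. f (d + u) \<partial>gauss s)
    = (\<integral>\<^sup>+u. f u * ennreal (exp ((d * u - d\<^sup>2 / 2) / s\<^sup>2)) \<partial>gauss s)"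
proof -
  have eq: "normal_density 0 s (u - d) = normal_density 0 s u * exp ((d * u - d\<^sup>2 / 2) / s\<^sup>2)" for u
  proof -
    have "- ((u - d)\<^sup>2) / (2 * s\<^sup>2) = - (u\<^sup>2) / (2 * s\<^sup>2) + (d * u - d\<^sup>2 / 2) / s\<^sup>2"
      using assms(1) by (simp add: field_simps power2_eq_square)
    then show ?thesis by (simp only: normal_density_def exp_add diff_0_right mult.assoc)
  qed
  have "(\<integral>\<^sup>+u. f (d + u) \<partial>gauss s) = (\<integral>\<^sup>+u. ennreal (normal_density 0 s u) * f (d + u) \<partial>lborel)"
    by (subst nn_integral_density) auto
  also have "\<dots> = (\<integral>\<^sup>+u. ennreal (normal_density 0 s (u - d)) * f u \<partial>lborel)"
    by (subst lborel_distr_plus[symmetric, of d], subst nn_integral_distr) auto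
  also have "\<dots> = (\<integral>\<^sup>+u. ennreal (normal_density 0 s u) * (f u * ennreal (exp ((d * u - d\<^sup>2 / 2) / s\<^sup>2))) \<partial>lborel)"
    unfolding eq by (intro nn_integral_cong) (simp add: ennreal_mult mult_ac)
  also have "\<dots> = (\<integral>\<^sup>+u. f u * ennreal (exp ((d * u - d\<^sup>2 / 2) / s\<^sup>2)) \<partial>gauss s)"
    by (subst nn_integral_density) auto
  finally show ?thesis .
qed

text \<open>Fubini's theorem integrates out the last noise variable, on which the first
  \<open>n\<close> factors do not depend. The function \<open>g\<close> of the endpoint is there to
  carry the inner integral on to the next application.\<close>

lemma nn_integral_walk_Suc:
  assumes "s > 0" and c[measurable]: "\<And>i. c i \<in> borel_measurable borel"
    and w[measurable]: "\<And>i. case_prod (w i) \<in> borel_measurable (borel \<Otimes>\<^sub>M borel)"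
    and g[measurable]: "g \<in> borel_measurable borel"
  shows "(\<integral>\<^sup>+z. (\<Prod>i<Suc n. w i (walk c x z i) (walk c x z (Suc i))) * g (walk c x z (Suc n))
            \<partial>PiM {..<Suc n} (\<lambda>_. gauss s))
    = (\<integral>\<^sup>+z. (\<Prod>i<n. w i (walk c x z i) (walk c x z (Suc i))) *
          (let y = walk c x z n in \<integral>\<^sup>+u. w n y (y + c n y + u) * g (y + c n y + u) \<partial>gauss s)
            \<partial>PiM {..<n} (\<lambda>_. gauss s))"
proof -
  interpret G: prob_space "gauss s" using assms(1) by (rule prob_space_normal_density)
  interpret product_sigma_finite "\<lambda>_::nat. gauss s" by standard
  have walk_meas[measurable]: "(\<lambda>z. walk c x z j) \<in> borel_measurable (PiM {..<k} (\<lambda>_. gauss s))" if "j \<le> k" for j k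
  proof (rule measurable_walk)
    fix l assume "l < j"
    then have "(\<lambda>z. z l) \<in> measurable (PiM {..<k} (\<lambda>_. gauss s)) (gauss s)"
      using that by (intro measurable_component_singleton) auto
    then show "(\<lambda>z. z l) \<in> borel_measurable (PiM {..<k} (\<lambda>_. gauss s))"
      by (simp cong: measurable_cong_sets)
  qed (rule c)
  have upd: "walk c x (z(n := u)) j = walk c x z j" if "j \<le> n" for z u j
    using that by (intro walk_cong) auto
  have wm: "(\<lambda>z. w i (walk c x z i) (walk c x z (Suc i))) \<in> borel_measurable (PiM {..<k} (\<lambda>_. gauss s))"
    if "i < k" for i k
    using that measurable_compose[OF measurable_Pair[OF walk_meas[of i k] walk_meas[of "Suc i" k]] w[of i]]
    by simp
  have "(\<integral>\<^sup>+z. (\<Prod>i<Suc n. w i (walk c x z i) (walk c x z (Suc i))) * g (walk c x z (Suc n))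
            \<partial>PiM {..<Suc n} (\<lambda>_. gauss s))
     = (\<integral>\<^sup>+z. \<integral>\<^sup>+u. (\<Prod>i<Suc n. w i (walk c x (z(n:=u)) i) (walk c x (z(n:=u)) (Suc i))) * g (walk c x (z(n:=u)) (Suc n))
            \<partial>gauss s \<partial>PiM {..<n} (\<lambda>_. gauss s))"
    unfolding lessThan_Suc
    apply (rule product_nn_integral_insert)
    subgoal by simp
    subgoal by simp
    subgoal
      unfolding lessThan_Suc[symmetric]
      by (intro borel_measurable_times_ennreal borel_measurable_prod_ennreal wm measurable_compose[OF walk_meas g]) auto
    done
  also have "\<dots> = (\<integral>\<^sup>+z. (\<Prod>i<n. w i (walk c x z i) (walk c x z (Suc i))) *
          (let y = walk c x z n in \<integral>\<^sup>+u. w n y (y + c n y + u) * g (y + c n y + u) \<partial>gauss s)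
            \<partial>PiM {..<n} (\<lambda>_. gauss s))"
  proof (intro nn_integral_cong)
    fix z
    have *: "(\<Prod>i<Suc n. w i (walk c x (z(n:=u)) i) (walk c x (z(n:=u)) (Suc i)))
        = (\<Prod>i<n. w i (walk c x z i) (walk c x z (Suc i))) * w n (walk c x z n) (walk c x z n + c n (walk c x z n) + u)" for u
      unfolding prod.lessThan_Suc
      by (intro arg_cong2[where f=times] prod.cong) (auto simp: upd simp del: walk.simps, simp add: upd)
    show "(\<integral>\<^sup>+u. (\<Prod>i<Suc n. w i (walk c x (z(n:=u)) i) (walk c x (z(n:=u)) (Suc i))) * g (walk c x (z(n:=u)) (Suc n)) \<partial>gauss s)
      = (\<Prod>i<n. w i (walk c x z i) (walk c x z (Suc i))) *
          (let y = walk c x z n in \<integral>\<^sup>+u. w n y (y + c n y + u) * g (y + c n y + u) \<partial>gauss s)"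
      unfolding * Let_def
      by (subst nn_integral_cmult[symmetric]) (auto simp: upd mult_ac)
  qed
  finally show ?thesis .
qed

text \<open>Steps are treated from the last to the first. Given the past, the displacement
  \<open>c n y\<close> is a constant, so the one-step shift removes it at the price of its density;
  the remaining inner integral becomes the endpoint function for \<open>n\<close> steps. This is why
  the induction needs arbitrary \<open>g\<close>.\<close>

lemma discrete_girsanov_PiM:
  assumes s: "s > 0" and c[measurable]: "\<And>i. c i \<in> borel_measurable borel"
    and w[measurable]: "\<And>i. case_prod (w i) \<in> borel_measurable (borel \<Otimes>\<^sub>M borel)"
    and g[measurable]: "g \<in> borel_measurable borel"
  shows "(\<integral>\<^sup>+z. (\<Prod>i<n. w i (walk c x z i) (walk c x z (Suc i))) * g (walk c x z n)
            \<partial>PiM {..<n} (\<lambda>_. gauss s))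
    = (\<integral>\<^sup>+z. (\<Prod>i<n. let y = walk (\<lambda>_ _. 0) x z i; y' = walk (\<lambda>_ _. 0) x z (Suc i) in
            w i y y' * ennreal (exp ((c i y * (y' - y) - (c i y)\<^sup>2 / 2) / s\<^sup>2))) *
          g (walk (\<lambda>_ _. 0) x z n) \<partial>PiM {..<n} (\<lambda>_. gauss s))"
  using g
proof (induction n arbitrary: g)
  case (Suc n)
  note [measurable] = Suc.prems
  interpret G: prob_space "gauss s" using assms(1) by (rule prob_space_normal_density)
  define W where "W i y y' = w i y y' * ennreal (exp ((c i y * (y' - y) - (c i y)\<^sup>2 / 2) / s\<^sup>2))" for i y y'
  have W[measurable]: "case_prod (W i) \<in> borel_measurable (borel \<Otimes>\<^sub>M borel)" for i
    unfolding W_def by measurable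
  have eq: "(\<integral>\<^sup>+u. w n y (y + c n y + u) * g (y + c n y + u) \<partial>gauss s)
      = (\<integral>\<^sup>+u. W n y (y + 0 + u) * g (y + 0 + u) \<partial>gauss s)" for y
    using nn_integral_gauss_shift[OF s, of "\<lambda>u. w n y (y + u) * g (y + u)" "c n y"]
    by (simp add: W_def mult_ac add_ac)
  let ?K = "\<lambda>y. \<integral>\<^sup>+u. W n y (y + 0 + u) * g (y + 0 + u) \<partial>gauss s"
  have K: "?K \<in> borel_measurable borel" by measurable
  show ?case
    unfolding Let_def W_def[symmetric]
    apply (subst nn_integral_walk_Suc[OF s c w Suc.prems])
    apply (subst nn_integral_walk_Suc[OF s _ W Suc.prems], simp)
    unfolding Let_def eq
    using Suc.IH[OF K] unfolding Let_def W_def[symmetric] .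
qed simp

text \<open>Restrictions on single steps are encoded as zero factors of a product; this turns them
  back into one event for the whole path.\<close>

lemma prod_if_exp:
  fixes P :: "nat \<Rightarrow> bool" and a :: "nat \<Rightarrow> real"
  shows "(\<Prod>i<k. if P i then ennreal (exp (a i)) else 0) = (if \<forall>i<k. P i then ennreal (exp (\<Sum>i<k. a i)) else 0)"
  by (induction k) (auto simp: exp_add ennreal_mult less_Suc_eq)

text \<open>After squaring, the claim is \<open>exp (- 2 * u) \<le> 1 - u\<close>, which follows
  from \<open>1 + 2 * u \<le> exp (2 * u)\<close> and
  \<open>(1 + 2 * u) * (1 - u) = 1 + u * (1 - 2 * u)\<close>.\<close>

lemma exp_neg_le_sqrt:
  fixes u :: real assumes "0 \<le> u" "u \<le> 1/2"
  shows "exp (- u) \<le> sqrt (1 - u)"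
proof -
  have "1 + 2 * u \<le> exp (2 * u)" by (rule exp_ge_add_one_self)
  moreover have "1 \<le> (1 + 2 * u) * (1 - u)"
  proof -
    have "0 \<le> u * (1 - 2 * u)" using assms by simp
    then show ?thesis by (simp add: algebra_simps)
  qed
  ultimately have "1 \<le> exp (2 * u) * (1 - u)"
    using assms mult_right_mono[of "1 + 2 * u" "exp (2 * u)" "1 - u"] by linarith
  then have "exp (- u) ^ 2 \<le> 1 - u"
    by (simp add: exp_double[symmetric] exp_minus field_simps)
  then show ?thesis by (rule real_le_rsqrt)
qed

section \<open>Change of drift and exponential moments for independent Gaussian steps\<close>

locale gaussian_steps = prob_space M for M :: "'a measure" +
  fixes Z :: "nat \<Rightarrow> 'a \<Rightarrow> real" and n :: nat and s :: real
  assumes n_pos: "n > 0" and s_pos: "s > 0"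
    and indep: "indep_vars (\<lambda>_. borel) Z {..<n}"
    and distributed_Z: "\<And>i. i < n \<Longrightarrow> distributed M lborel (Z i) (normal_density 0 s)"
begin

lemma measurable_Z: "i < n \<Longrightarrow> Z i \<in> borel_measurable M"
  using distributed_measurable[OF distributed_Z] by simp

lemma measurable_walk_Z:
  assumes "\<And>i. c i \<in> borel_measurable borel" "i \<le> n"
  shows "(\<lambda>\<omega>. walk c x (\<lambda>j. Z j \<omega>) i) \<in> borel_measurable M"
  by (rule measurable_walk) (use assms measurable_Z in auto)

lemma distr_Z:
  "distr M (PiM {..<n} (\<lambda>_. borel)) (\<lambda>\<omega>. \<lambda>i\<in>{..<n}. Z i \<omega>) = PiM {..<n} (\<lambda>_. gauss s)"
proof -
  have "distr M (PiM {..<n} (\<lambda>_. borel)) (\<lambda>\<omega>. \<lambda>i\<in>{..<n}. Z i \<omega>) = PiM {..<n} (\<lambda>i. distr M borel (Z i))"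
    using indep_vars_iff_distr_eq_PiM'[where I="{..<n}" and M'="\<lambda>_. borel" and X=Z] indep n_pos measurable_Z by auto
  also have "\<dots> = PiM {..<n} (\<lambda>_. gauss s)"
  proof (intro PiM_cong refl)
    fix i assume "i \<in> {..<n}"
    then have "distr M lborel (Z i) = gauss s" by (simp add: distributed_distr_eq_density[OF distributed_Z])
    then show "distr M borel (Z i) = gauss s" by (metis distr_cong sets_lborel)
  qed
  finally show ?thesis .
qed

lemma nn_integral_walk_PiM:
  assumes c[measurable]: "\<And>i. c i \<in> borel_measurable borel"
    and w[measurable]: "\<And>i. case_prod (w i) \<in> borel_measurable (borel \<Otimes>\<^sub>M borel)"
  shows "(\<integral>\<^sup>+\<omega>. (\<Prod>i<n. w i (walk c x (\<lambda>j. Z j \<omega>) i) (walk c x (\<lambda>j. Z j \<omega>) (Suc i))) \<partial>M)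
     = (\<integral>\<^sup>+z. (\<Prod>i<n. w i (walk c x z i) (walk c x z (Suc i))) \<partial>PiM {..<n} (\<lambda>_. gauss s))"
proof -
  have Zm: "(\<lambda>\<omega>. \<lambda>i\<in>{..<n}. Z i \<omega>) \<in> measurable M (PiM {..<n} (\<lambda>_. borel))"
    by (rule measurable_restrict) (simp add: measurable_Z)
  have walk_meas: "(\<lambda>z. walk c x z j) \<in> borel_measurable (PiM {..<n} (\<lambda>_. borel))" if "j \<le> n" for j
    by (rule measurable_walk) (use that c in \<open>auto intro!: measurable_component_singleton\<close>)
  have "(\<integral>\<^sup>+z. (\<Prod>i<n. w i (walk c x z i) (walk c x z (Suc i))) \<partial>PiM {..<n} (\<lambda>_. gauss s))
    = (\<integral>\<^sup>+\<omega>. (\<Prod>i<n. w i (walk c x (\<lambda>i\<in>{..<n}. Z i \<omega>) i) (walk c x (\<lambda>i\<in>{..<n}. Z i \<omega>) (Suc i))) \<partial>M)"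
    unfolding distr_Z[symmetric]
    by (subst nn_integral_distr[OF Zm])
       (auto intro!: borel_measurable_prod_ennreal measurable_compose[OF measurable_Pair[OF walk_meas walk_meas] w, simplified] simp del: walk.simps)
  also have "\<dots> = (\<integral>\<^sup>+\<omega>. (\<Prod>i<n. w i (walk c x (\<lambda>j. Z j \<omega>) i) (walk c x (\<lambda>j. Z j \<omega>) (Suc i))) \<partial>M)"
  proof (intro nn_integral_cong prod.cong refl)
    fix \<omega> i assume "i \<in> {..<n}"
    then show "w i (walk c x (\<lambda>i\<in>{..<n}. Z i \<omega>) i) (walk c x (\<lambda>i\<in>{..<n}. Z i \<omega>) (Suc i))
      = w i (walk c x (\<lambda>j. Z j \<omega>) i) (walk c x (\<lambda>j. Z j \<omega>) (Suc i))"
      by (intro arg_cong2[where f="w i"] walk_cong) auto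
  qed
  finally show ?thesis by simp
qed

text \<open>The product form is specialised to factors that combine a step restriction
  \<open>G\<close> with an exponential weight \<open>A\<close>. Both sides use the same noise
  \<open>Z\<close>; the displacement \<open>c\<close> disappears from the walk and its density
  enters the exponent.\<close>

lemma discrete_girsanov:
  fixes x :: real and c :: "nat \<Rightarrow> real \<Rightarrow> real"
  assumes c[measurable]: "\<And>i. c i \<in> borel_measurable borel"
    and G[measurable]: "\<And>i. Measurable.pred (borel \<Otimes>\<^sub>M borel) (case_prod (G i))"
    and A[measurable]: "\<And>i. case_prod (A i) \<in> borel_measurable (borel \<Otimes>\<^sub>M borel)"
  defines "Y \<equiv> \<lambda>\<omega>. walk c x (\<lambda>j. Z j \<omega>)" and "B \<equiv> \<lambda>\<omega>. walk (\<lambda>_ _. 0) x (\<lambda>j. Z j \<omega>)"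
  shows "(\<integral>\<^sup>+\<omega>. (if \<forall>i<n. G i (Y \<omega> i) (Y \<omega> (Suc i))
            then ennreal (exp (\<Sum>i<n. A i (Y \<omega> i) (Y \<omega> (Suc i)))) else 0) \<partial>M)
    = (\<integral>\<^sup>+\<omega>. (if \<forall>i<n. G i (B \<omega> i) (B \<omega> (Suc i))
            then ennreal (exp (\<Sum>i<n. A i (B \<omega> i) (B \<omega> (Suc i)) +
              (c i (B \<omega> i) * (B \<omega> (Suc i) - B \<omega> i) - (c i (B \<omega> i))\<^sup>2 / 2) / s\<^sup>2)) else 0) \<partial>M)"
proof -
  define w where "w i y y' = (if G i y y' then ennreal (exp (A i y y')) else 0)" for i y y'
  have [measurable]: "case_prod (w i) \<in> borel_measurable (borel \<Otimes>\<^sub>M borel)" for i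
  proof -
    have "(\<lambda>p. if case_prod (G i) p then ennreal (exp (case_prod (A i) p)) else 0) \<in> borel_measurable (borel \<Otimes>\<^sub>M borel)"
      by measurable
    then show ?thesis by (simp add: w_def case_prod_beta')
  qed
  define w' where "w' i y y' = w i y y' * ennreal (exp ((c i y * (y' - y) - (c i y)\<^sup>2 / 2) / s\<^sup>2))" for i y y'
  have [measurable]: "case_prod (w' i) \<in> borel_measurable (borel \<Otimes>\<^sub>M borel)" for i
    unfolding w'_def by measurable
  have w': "w' i y y' = (if G i y y' then ennreal (exp (A i y y' + (c i y * (y' - y) - (c i y)\<^sup>2 / 2) / s\<^sup>2)) else 0)" for i y y'
    by (simp add: w'_def w_def exp_add ennreal_mult)
  have "(\<integral>\<^sup>+\<omega>. (\<Prod>i<n. w i (Y \<omega> i) (Y \<omega> (Suc i))) \<partial>M) = (\<integral>\<^sup>+\<omega>. (\<Prod>i<n. w' i (B \<omega> i) (B \<omega> (Suc i))) \<partial>M)"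
    unfolding Y_def B_def
    apply (subst nn_integral_walk_PiM, simp, simp)
    apply (subst nn_integral_walk_PiM, simp, simp)
    using discrete_girsanov_PiM[OF s_pos, where c=c and w=w and g="\<lambda>_. 1" and n=n and x=x]
    by (simp add: Let_def w'_def del: walk.simps)
  then show ?thesis by (simp only: w_def w' prod_if_exp)
qed

text \<open>A supermartingale argument: given the past, each factor has mean at most one, so
  integrating the factors away from the last to the first never increases the bound.\<close>

lemma nn_integral_walk_prod_le_1:
  fixes x :: real and w :: "nat \<Rightarrow> real \<Rightarrow> real \<Rightarrow> ennreal"
  assumes w[measurable]: "\<And>i. case_prod (w i) \<in> borel_measurable (borel \<Otimes>\<^sub>M borel)"
    and le: "\<And>i y. (\<integral>\<^sup>+u. w i y (y + u) \<partial>gauss s) \<le> 1"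
  defines "B \<equiv> \<lambda>\<omega>. walk (\<lambda>_ _. 0) x (\<lambda>j. Z j \<omega>)"
  shows "(\<integral>\<^sup>+\<omega>. (\<Prod>i<n. w i (B \<omega> i) (B \<omega> (Suc i))) \<partial>M) \<le> 1"
proof -
  let ?b = "\<lambda>z. walk (\<lambda>_ _. 0) x z"
  have "(\<integral>\<^sup>+z. (\<Prod>i<k. w i (?b z i) (?b z (Suc i))) \<partial>PiM {..<k} (\<lambda>_. gauss s)) \<le> 1" for k
  proof (induction k)
    case 0
    interpret G: prob_space "gauss s" using s_pos by (rule prob_space_normal_density)
    interpret product_prob_space "\<lambda>_. gauss s" "{..<0::nat}" by standard
    show ?case using emeasure_space_1 by simp
  next
    case (Suc k)
    have "(\<integral>\<^sup>+z. (\<Prod>i<Suc k. w i (?b z i) (?b z (Suc i))) \<partial>PiM {..<Suc k} (\<lambda>_. gauss s))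
      = (\<integral>\<^sup>+z. (\<Prod>i<k. w i (?b z i) (?b z (Suc i))) * (\<integral>\<^sup>+u. w k (?b z k) (?b z k + u) \<partial>gauss s) \<partial>PiM {..<k} (\<lambda>_. gauss s))"
      using nn_integral_walk_Suc[OF s_pos _ w, where c="\<lambda>_ _. 0" and g="\<lambda>_. 1" and n=k and x=x] by (simp add: Let_def del: walk.simps)
    also have "\<dots> \<le> (\<integral>\<^sup>+z. (\<Prod>i<k. w i (?b z i) (?b z (Suc i))) * 1 \<partial>PiM {..<k} (\<lambda>_. gauss s))"
      by (intro nn_integral_mono mult_left_mono le) auto
    finally show ?case using Suc by simp
  qed
  then show ?thesis
    unfolding B_def by (subst nn_integral_walk_PiM) auto
qed

text \<open>Conditionally on the past, \<open>\<gamma>(B\<^sub>i) Z\<^sub>i\<^sup>2\<close> is compensated by \<open>2 \<gamma>(B\<^sub>i) s\<^sup>2\<close>; the compensator is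
  split off by the arithmetic--geometric mean inequality.\<close>

lemma nn_integral_exp_squares_le:
  fixes x :: real and \<gamma> :: "real \<Rightarrow> real"
  assumes \<gamma>[measurable]: "\<gamma> \<in> borel_measurable borel"
    and bd: "\<And>y. 0 \<le> \<gamma> y" "\<And>y. 2 * \<gamma> y * s\<^sup>2 \<le> 1/2"
  defines "B \<equiv> \<lambda>\<omega>. walk (\<lambda>_ _. 0) x (\<lambda>j. Z j \<omega>)"
  shows "(\<integral>\<^sup>+\<omega>. ennreal (exp (1/2 * (\<Sum>i<n. \<gamma> (B \<omega> i) * (Z i \<omega>)\<^sup>2))) \<partial>M)
    \<le> 1 + (\<integral>\<^sup>+\<omega>. ennreal (exp (2 * s\<^sup>2 * (\<Sum>i<n. \<gamma> (B \<omega> i)))) \<partial>M)"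
proof -
  define a where "a y y' = \<gamma> y * (y' - y)\<^sup>2 - 2 * s\<^sup>2 * \<gamma> y" for y y'
  have [measurable]: "case_prod a \<in> borel_measurable (borel \<Otimes>\<^sub>M borel)"
    unfolding a_def by measurable
  have B: "(\<lambda>\<omega>. B \<omega> i) \<in> borel_measurable M" if "i \<le> n" for i
    unfolding B_def using that by (intro measurable_walk_Z) auto
  have 1: "(\<integral>\<^sup>+u. ennreal (exp (a y (y + u))) \<partial>gauss s) \<le> 1" for y
  proof -
    \<comment> \<open>The Gaussian integral of \<open>exp (\<gamma> y * u\<^sup>2)\<close> is
      \<open>1 / sqrt (1 - v)\<close>; as \<open>v\<close> is at most one half, the compensator
      \<open>exp (- v)\<close> outweighs it.\<close>
    define v where "v = 2 * \<gamma> y * s\<^sup>2"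
    have v: "0 \<le> v" "v \<le> 1/2" using bd by (auto simp: v_def)
    have "(\<integral>\<^sup>+u. ennreal (exp (a y (y + u))) \<partial>gauss s)
       = (\<integral>\<^sup>+u. ennreal (exp (-v)) * ennreal (exp (\<gamma> y * u\<^sup>2)) \<partial>gauss s)"
      by (intro nn_integral_cong) (simp add: a_def v_def ennreal_mult[symmetric] exp_add[symmetric] mult_ac)
    also have "\<dots> = ennreal (exp (-v)) * (\<integral>\<^sup>+u. ennreal (exp (\<gamma> y * u\<^sup>2)) \<partial>gauss s)"
      by (rule nn_integral_cmult) simp
    also have "\<dots> = ennreal (exp (-v) / sqrt (1 - v))"
      using v by (subst nn_integral_gauss_exp_square[OF s_pos]) (auto simp: v_def ennreal_mult[symmetric])
    also have "\<dots> \<le> 1"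
      using exp_neg_le_sqrt[OF v] v by (intro ennreal_le_1[THEN iffD2]) (simp add: divide_le_eq)
    finally show ?thesis .
  qed
  have step: "B \<omega> (Suc i) - B \<omega> i = Z i \<omega>" for \<omega> i by (simp add: B_def)
  let ?P = "\<lambda>\<omega>. \<Sum>i<n. \<gamma> (B \<omega> i) * (Z i \<omega>)\<^sup>2" and ?U = "\<lambda>\<omega>. 2 * s\<^sup>2 * (\<Sum>i<n. \<gamma> (B \<omega> i))"
  have PU: "?P \<omega> - ?U \<omega> = (\<Sum>i<n. a (B \<omega> i) (B \<omega> (Suc i)))" for \<omega>
    unfolding a_def step by (simp add: sum_subtractf sum_distrib_left)
  have sq: "exp (v / 2) ^ 2 = exp v" for v :: real using exp_double[of "v / 2"] by simp
  have "exp (1/2 * ?P \<omega>) \<le> exp (?P \<omega> - ?U \<omega>) + exp (?U \<omega>)" for \<omega>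
  proof -
    have "exp (1/2 * ?P \<omega>) = exp ((?P \<omega> - ?U \<omega>) / 2) * exp (?U \<omega> / 2)"
      by (simp add: exp_add[symmetric] field_simps)
    also have "\<dots> \<le> exp ((?P \<omega> - ?U \<omega>) / 2) ^ 2 + exp (?U \<omega> / 2) ^ 2"
      using sum_squares_bound[of "exp ((?P \<omega> - ?U \<omega>) / 2)" "exp (?U \<omega> / 2)"]
        mult_pos_pos[OF exp_gt_zero[of "(?P \<omega> - ?U \<omega>) / 2"] exp_gt_zero[of "?U \<omega> / 2"]]
      by linarith
    finally show ?thesis unfolding sq .
  qed
  then have "(\<integral>\<^sup>+\<omega>. ennreal (exp (1/2 * ?P \<omega>)) \<partial>M)
     \<le> (\<integral>\<^sup>+\<omega>. ennreal (exp (?P \<omega> - ?U \<omega>)) + ennreal (exp (?U \<omega>)) \<partial>M)"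
    by (intro nn_integral_mono) (simp add: ennreal_plus[symmetric] del: ennreal_plus)
  also have "\<dots> = (\<integral>\<^sup>+\<omega>. ennreal (exp (?P \<omega> - ?U \<omega>)) \<partial>M) + (\<integral>\<^sup>+\<omega>. ennreal (exp (?U \<omega>)) \<partial>M)"
  proof (rule nn_integral_add)
    have m: "(\<lambda>\<omega>. \<gamma> (B \<omega> i)) \<in> borel_measurable M" "Z i \<in> borel_measurable M" if "i < n" for i
      using measurable_compose[OF B \<gamma>] measurable_Z that by auto
    show "(\<lambda>\<omega>. ennreal (exp (?P \<omega> - ?U \<omega>))) \<in> borel_measurable M"
      "(\<lambda>\<omega>. ennreal (exp (?U \<omega>))) \<in> borel_measurable M"
      by (intro measurable_compose[OF _ measurable_ennreal] measurable_compose[OF _ borel_measurable_exp]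
          borel_measurable_diff borel_measurable_sum borel_measurable_times borel_measurable_power borel_measurable_const m;
          simp)+
  qed
  also have "(\<integral>\<^sup>+\<omega>. ennreal (exp (?P \<omega> - ?U \<omega>)) \<partial>M)
      = (\<integral>\<^sup>+\<omega>. (\<Prod>i<n. ennreal (exp (a (B \<omega> i) (B \<omega> (Suc i))))) \<partial>M)"
    unfolding PU by (simp add: exp_sum prod_ennreal)
  also have "\<dots> \<le> 1"
    unfolding B_def by (rule nn_integral_walk_prod_le_1) (use 1 in auto)
  finally show ?thesis by (simp add: add_right_mono)
qed

end

section \<open>Drifts and the deterministic Euler scheme\<close>

lemma drift_has_derivative:
  assumes "b \<in> drift_class"
  shows "(b has_real_derivative deriv b y) (at y)"
proof -
  obtain D where "\<And>y. (b has_real_derivative D y) (at y)"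
    using assms unfolding drift_class_def C1_differentiable_on_def
      has_real_derivative_iff_has_vector_derivative[symmetric] by auto
  then show ?thesis using DERIV_imp_deriv by metis
qed

lemma continuous_on_deriv_drift:
  assumes "b \<in> drift_class"
  shows "continuous_on UNIV (deriv b)"
proof -
  obtain D where "\<And>y. (b has_real_derivative D y) (at y)" "continuous_on UNIV D"
    using assms unfolding drift_class_def C1_differentiable_on_def
      has_real_derivative_iff_has_vector_derivative[symmetric] by auto
  then have "deriv b = D" using DERIV_imp_deriv by blast
  then show ?thesis using \<open>continuous_on UNIV D\<close> by simp
qed

lemma drift_isCont: "b \<in> drift_class \<Longrightarrow> isCont b y"
  using drift_has_derivative DERIV_isCont by blast

lemma continuous_on_drift: "b \<in> drift_class \<Longrightarrow> continuous_on A b"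
  by (simp add: continuous_at_imp_continuous_on drift_isCont)

lemma drift_less: "b \<in> drift_class \<Longrightarrow> u < v \<Longrightarrow> b v < b u"
  by (auto simp: drift_class_def monotone_on_def)

lemma neg_slope_nonneg:
  assumes "b \<in> drift_class"
  shows "neg_slope b y \<ge> 0"
proof (rule ccontr)
  assume "\<not> neg_slope b y \<ge> 0"
  then have "deriv b y > 0" by (simp add: neg_slope_def)
  then obtain d where "d > 0" "\<forall>h>0. h < d \<longrightarrow> b y < b (y + h)"
    using DERIV_pos_inc_right[OF drift_has_derivative[OF assms]] by blast
  then have "b y < b (y + d/2)" by simp
  then show False using drift_less[OF assms, of y "y + d/2"] \<open>d > 0\<close> by simp
qed

text \<open>The drift is nonnegative to the left of \<theta> and nonpositive to the right, so an
  antiderivative increases up to \<theta> and decreases afterwards.\<close>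

lemma drift_potential:
  assumes b: "b \<in> drift_class" "b \<theta> = 0"
  obtains L where "\<And>y. (L has_real_derivative b y) (at y)" "\<And>y. L y \<le> L \<theta>"
proof -
  obtain L where L': "\<And>y. (L has_real_derivative b y) (at y)"
    using einterval_antiderivative[of "-\<infinity>" "\<infinity>" b] drift_isCont[OF b(1)]
    unfolding has_real_derivative_iff_has_vector_derivative by auto
  have "L y \<le> L \<theta>" for y
  proof (cases "y \<le> \<theta>")
    case True
    have "0 \<le> b u" if "u \<le> \<theta>" for u
      using drift_less[OF b(1), of u \<theta>] b(2) that by (cases "u = \<theta>") auto
    then show ?thesis using L' by (intro DERIV_nonneg_imp_nondecreasing[OF True]) blast
  next
    case False
    have "b u \<le> 0" if "\<theta> \<le> u" for u
      using drift_less[OF b(1), of \<theta> u] b(2) that by (cases "u = \<theta>") auto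
    then show ?thesis using L' False by (intro DERIV_nonpos_imp_nonincreasing[of \<theta> y]) (simp, blast)
  qed
  with L' show ?thesis by (rule that)
qed

text \<open>Second-order Taylor expansion of the potential, whose second derivative is minus the
  negative slope. It plays the part of Ito's formula over one step: the intermediate point
  \<open>v\<close> stays unspecified, since only bounds for the slope on the segment are
  used.\<close>

lemma drift_taylor:
  assumes b: "b \<in> drift_class" and L: "\<And>y. (L has_real_derivative b y) (at y)"
  obtains v where "v \<in> closed_segment y y'"
    "b y * (y' - y) = L y' - L y + neg_slope b v / 2 * (y' - y)\<^sup>2"
proof (cases "y' = y")
  case True
  then show ?thesis by (intro that[of y]) auto
next
  case False
  define diff where "diff m = (if m = 0 then L else if m = 1 then b else deriv b)" for m :: nat
  have "\<exists>t. (if y' < y then y' < t \<and> t < y else y < t \<and> t < y') \<and>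
    L y' = (\<Sum>m<2. (diff m y / fact m) * (y' - y)^m) + (diff 2 t / fact 2) * (y' - y)^2"
    by (rule Taylor[where a="min y y'" and b="max y y'"])
      (use False L drift_has_derivative[OF b] in \<open>auto simp: diff_def\<close>)
  then obtain t where t: "if y' < y then y' < t \<and> t < y else y < t \<and> t < y'"
    "L y' = (\<Sum>m<2. (diff m y / fact m) * (y' - y)^m) + (diff 2 t / fact 2) * (y' - y)^2" by blast
  have "b y * (y' - y) = L y' - L y + neg_slope b t / 2 * (y' - y)\<^sup>2"
    using t(2) by (simp add: diff_def neg_slope_def numeral_2_eq_2)
  moreover have "t \<in> closed_segment y y'"
    using t(1) by (auto simp: closed_segment_eq_real_ivl split: if_splits)
  ultimately show ?thesis by (rule that[rotated])
qed

section \<open>Pathwise convergence of the Euler scheme and of Riemann sums along it\<close>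

lemma abs_integral_sub_le:
  fixes f :: "real \<Rightarrow> real"
  assumes "a \<le> c" "continuous_on {a..c} f" "\<And>s. s \<in> {a..c} \<Longrightarrow> \<bar>f s - k\<bar> \<le> B"
  shows "\<bar>integral {a..c} f - (c - a) * k\<bar> \<le> (c - a) * B"
proof -
  have f: "f integrable_on {a..c}" using assms(2) by (rule integrable_continuous_interval)
  have "integral {a..c} (\<lambda>s. f s - k) = integral {a..c} f - (c - a) * k"
    using f assms(1) by (subst Henstock_Kurzweil_Integration.integral_diff) (auto simp: mult_ac)
  moreover have "norm (integral {a..c} (\<lambda>s. f s - k)) \<le> integral {a..c} (\<lambda>_. B)"
    using assms f by (intro integral_norm_bound_integral integrable_diff) auto
  ultimately show ?thesis using assms(1) by (simp add: mult_ac)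
qed

lemma integral_grid:
  fixes f :: "real \<Rightarrow> real"
  assumes "h \<ge> 0" "continuous_on {0..} f"
  shows "integral {0..real n * h} f = (\<Sum>i<n. integral {real i * h..real (Suc i) * h} f)"
proof (induction n)
  case (Suc n)
  have "continuous_on {0..real (Suc n) * h} f" using assms(2) by (rule continuous_on_subset) auto
  then have "f integrable_on {0..real (Suc n) * h}" by (rule integrable_continuous_interval)
  then have "integral {0..real n * h} f + integral {real n * h..real (Suc n) * h} f = integral {0..real (Suc n) * h} f"
    using assms(1) by (intro Henstock_Kurzweil_Integration.integral_combine) (auto simp: field_simps)
  then show ?case using Suc by simp
qed simp

lemma path_bounded_uniform:
  fixes \<xi> :: "real \<Rightarrow> real"
  assumes "continuous_on {0..} \<xi>"
  obtains K where "K > 0" "\<And>t. t \<in> {0..T} \<Longrightarrow> \<bar>\<xi> t\<bar> \<le> K"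
    "\<And>e. e > 0 \<Longrightarrow> \<exists>d>0. \<forall>s\<in>{0..T}. \<forall>t\<in>{0..T}. \<bar>s - t\<bar> < d \<longrightarrow> \<bar>\<xi> s - \<xi> t\<bar> < e"
proof -
  have c: "continuous_on {0..T} \<xi>" using assms by (rule continuous_on_subset) auto
  obtain K where "K > 0" "\<And>t. t \<in> {0..T} \<Longrightarrow> \<bar>\<xi> t\<bar> \<le> K"
    using compact_imp_bounded[OF compact_continuous_image[OF c compact_Icc]]
    by (auto simp: bounded_pos)
  moreover have "\<exists>d>0. \<forall>s\<in>{0..T}. \<forall>t\<in>{0..T}. \<bar>s - t\<bar> < d \<longrightarrow> \<bar>\<xi> s - \<xi> t\<bar> < e" if "e > 0" for e
    using compact_uniformly_continuous[OF c compact_Icc] that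
    unfolding uniformly_continuous_on_def dist_real_def by (metis abs_minus_commute)
  ultimately show ?thesis by (rule that) 
qed

lemma eventually_step_less:
  assumes "d > 0"
  shows "eventually (\<lambda>n. T / real n < d) sequentially"
proof -
  have "(\<lambda>n. T / real n) \<longlonglongrightarrow> 0" by (rule lim_const_over_n)
  then show ?thesis using assms by (rule order_tendstoD)
qed

text \<open>A discrete Gronwall argument for one fixed path. The noise is additive and cancels from
  the error, and on a bounded range the drift is Lipschitz with some constant \<open>l\<close>, so
  the error grows by a factor \<open>1 + l * h\<close> per step, plus the contribution of the
  oscillation of the path within the step.\<close>

lemma euler_converges:
  assumes b: "b \<in> drift_class" and T: "T > 0"
    and \<xi>: "continuous_on {0..} \<xi>" "\<xi> 0 = x"
    and eq: "\<And>t. t \<ge> 0 \<Longrightarrow> \<xi> t = x + integral {0..t} (\<lambda>s. b (\<xi> s)) + w t"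
    and e: "e > 0"
  shows "eventually (\<lambda>n. \<forall>i\<le>n. \<bar>\<xi> (real i * (T / real n)) -
     walk (\<lambda>_ y. T / real n * b y) x (\<lambda>i. w (real (Suc i) * (T / real n)) - w (real i * (T / real n))) i\<bar> \<le> e) sequentially"
proof -
  obtain K where K: "K > 0" "\<And>t. t \<in> {0..T} \<Longrightarrow> \<bar>\<xi> t\<bar> \<le> K"
    and uc: "\<And>e. e > 0 \<Longrightarrow> \<exists>d>0. \<forall>s\<in>{0..T}. \<forall>t\<in>{0..T}. \<bar>s - t\<bar> < d \<longrightarrow> \<bar>\<xi> s - \<xi> t\<bar> < e"
    using path_bounded_uniform[OF \<xi>(1)] by metis
  have "continuous_on {-(K+1)..K+1} (deriv b)"
    using continuous_on_deriv_drift[OF b] by (rule continuous_on_subset) auto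
  from compact_imp_bounded[OF compact_continuous_image[OF this compact_Icc]]
  obtain l where l: "l > 0" "\<And>y. y \<in> {-(K+1)..K+1} \<Longrightarrow> \<bar>deriv b y\<bar> \<le> l"
    by (auto simp: bounded_pos)
  have lip: "\<bar>b u - b v\<bar> \<le> l * \<bar>u - v\<bar>" if "\<bar>u\<bar> \<le> K + 1" "\<bar>v\<bar> \<le> K + 1" for u v
    using field_differentiable_bound[of "{-(K+1)..K+1}" b "deriv b" l u v] that l
      DERIV_subset[OF drift_has_derivative[OF b]] by (auto simp: abs_le_iff)
  \<comment> \<open>Capping the error at one keeps the scheme inside \<open>{-(K+1)..K+1}\<close>,
    where \<open>l\<close> is a Lipschitz constant. The factor in \<open>\<eta>\<close> compensates
    the growth \<open>exp (l * T)\<close>.\<close>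
  define e' where "e' = min e 1"
  define \<eta> where "\<eta> = e' * exp (- l * T)"
  have \<eta>: "\<eta> > 0" using e by (simp add: \<eta>_def e'_def)
  obtain d where d: "d > 0" "\<And>s t. s \<in> {0..T} \<Longrightarrow> t \<in> {0..T} \<Longrightarrow> \<bar>s - t\<bar> < d \<Longrightarrow> \<bar>\<xi> s - \<xi> t\<bar> < \<eta>"
    using uc[OF \<eta>] by blast
  show ?thesis
    using eventually_step_less[OF d(1), of T] eventually_gt_at_top[of 0]
  proof eventually_elim
    case (elim n)
    define h where "h = T / real n"
    have h: "h > 0" "real n * h = T" "h < d" using elim T by (auto simp: h_def)
    define Y where "Y = walk (\<lambda>_ y. h * b y) x (\<lambda>i. w (real (Suc i) * h) - w (real i * h))"
    have grid: "real i * h \<in> {0..T}" if "i \<le> n" for i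
      using that h by (auto simp flip: h(2) intro!: mult_right_mono)
    have small: "\<eta> * ((1 + l * h) ^ i - 1) \<le> e'" if "i \<le> n" for i
    proof -
      have "(1 + l * h) ^ i \<le> exp (l * h) ^ i"
        using l(1) h by (intro power_mono exp_ge_add_one_self) auto
      also have "\<dots> = exp (l * (real i * h))" by (simp add: exp_of_nat_mult[symmetric] mult_ac)
      also have "\<dots> \<le> exp (l * T)" using grid[OF that] l by simp
      finally have "\<eta> * ((1 + l * h) ^ i - 1) \<le> \<eta> * exp (l * T)" using \<eta> by (intro mult_left_mono) auto
      also have "\<dots> = e'" by (simp add: \<eta>_def mult.assoc exp_add[symmetric])
      finally show ?thesis .
    qed
    \<comment> \<open>The bound is the exact solution of the recursion
      \<open>A \<mapsto> A + h * (l * (\<eta> + A))\<close> started at zero.\<close>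
    have err: "\<bar>\<xi> (real i * h) - Y i\<bar> \<le> \<eta> * ((1 + l * h) ^ i - 1)" if "i \<le> n" for i
      using that
    proof (induction i)
      case 0
      then show ?case using \<xi>(2) by (simp add: Y_def)
    next
      case (Suc i)
      define A where "A = \<eta> * ((1 + l * h) ^ i - 1)"
      have IH: "\<bar>\<xi> (real i * h) - Y i\<bar> \<le> A" using Suc by (simp add: A_def)
      have "A \<le> 1" using small[of i] Suc.prems by (simp add: A_def e'_def)
      have g: "real i * h \<in> {0..T}" "real (Suc i) * h \<in> {0..T}" using grid[of i] grid[of "Suc i"] Suc.prems by auto
      have \<xi>i: "\<bar>\<xi> (real i * h)\<bar> \<le> K" using K(2) g by blast
      then have Yi: "\<bar>Y i\<bar> \<le> K + 1" using IH \<open>A \<le> 1\<close> by linarith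
      have cont: "continuous_on {0..} (\<lambda>s. b (\<xi> s))"
        by (rule continuous_on_compose2[OF continuous_on_drift[OF b] \<xi>(1)]) auto
      have le: "real i * h \<le> real (Suc i) * h" using h by simp
      have sub: "{real i * h..real (Suc i) * h} \<subseteq> {0..T}" using g by auto
      have "\<bar>integral {real i * h..real (Suc i) * h} (\<lambda>s. b (\<xi> s)) - (real (Suc i) * h - real i * h) * b (Y i)\<bar>
        \<le> (real (Suc i) * h - real i * h) * (l * (\<eta> + A))"
      proof (rule abs_integral_sub_le[OF le])
        show "continuous_on {real i * h..real (Suc i) * h} (\<lambda>s. b (\<xi> s))"
          using cont sub by (auto intro: continuous_on_subset)
        fix s assume s: "s \<in> {real i * h..real (Suc i) * h}"
        then have "s \<in> {0..T}" using sub by blast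
        moreover have "\<bar>s - real i * h\<bar> < d" using s h by (auto simp: field_simps)
        ultimately have "\<bar>\<xi> s - \<xi> (real i * h)\<bar> < \<eta>" "\<bar>\<xi> s\<bar> \<le> K" using d(2) g K(2) by blast+
        then have "\<bar>\<xi> s - Y i\<bar> \<le> \<eta> + A" using IH by linarith
        have "\<bar>b (\<xi> s) - b (Y i)\<bar> \<le> l * \<bar>\<xi> s - Y i\<bar>" using lip Yi \<open>\<bar>\<xi> s\<bar> \<le> K\<close> by simp
        also have "\<dots> \<le> l * (\<eta> + A)" using \<open>\<bar>\<xi> s - Y i\<bar> \<le> \<eta> + A\<close> l by simp
        finally show "\<bar>b (\<xi> s) - b (Y i)\<bar> \<le> l * (\<eta> + A)" .
      qed
      then have I: "\<bar>integral {real i * h..real (Suc i) * h} (\<lambda>s. b (\<xi> s)) - h * b (Y i)\<bar> \<le> h * (l * (\<eta> + A))"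
        by (simp add: algebra_simps)
      have "(\<lambda>s. b (\<xi> s)) integrable_on {0..real (Suc i) * h}"
        using cont by (intro integrable_continuous_interval) (auto intro: continuous_on_subset)
      then have "integral {0..real i * h} (\<lambda>s. b (\<xi> s)) + integral {real i * h..real (Suc i) * h} (\<lambda>s. b (\<xi> s))
         = integral {0..real (Suc i) * h} (\<lambda>s. b (\<xi> s))"
        using g le by (intro Henstock_Kurzweil_Integration.integral_combine) auto
      then have "\<xi> (real (Suc i) * h) - \<xi> (real i * h)
         = integral {real i * h..real (Suc i) * h} (\<lambda>s. b (\<xi> s)) + (w (real (Suc i) * h) - w (real i * h))"
        using eq[of "real (Suc i) * h"] eq[of "real i * h"] g by auto
      \<comment> \<open>The noise increments of the solution and of the scheme are equal and drop
        out.\<close>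
      then have "\<xi> (real (Suc i) * h) - Y (Suc i) = (\<xi> (real i * h) - Y i)
         + (integral {real i * h..real (Suc i) * h} (\<lambda>s. b (\<xi> s)) - h * b (Y i))"
        by (simp add: Y_def)
      then have "\<bar>\<xi> (real (Suc i) * h) - Y (Suc i)\<bar> \<le> A + h * (l * (\<eta> + A))" using IH I by linarith
      also have "\<dots> = \<eta> * ((1 + l * h) ^ Suc i - 1)" by (simp add: A_def algebra_simps)
      finally show ?case .
    qed
    show ?case
      using order_trans[OF err small] unfolding e'_def Y_def h_def by auto
  qed
qed

text \<open>On each cell the path is near its value at the left node, which is near
  \<open>Y n i\<close>; uniform continuity of \<open>\<phi>\<close> on a bounded interval then
  controls the error of every cell at once.\<close>

lemma riemann_sum_converges:
  fixes \<phi> \<xi> :: "real \<Rightarrow> real" and Y :: "nat \<Rightarrow> nat \<Rightarrow> real"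
  assumes T: "T > 0" and \<xi>: "continuous_on {0..} \<xi>" and \<phi>: "continuous_on UNIV \<phi>"
    and Y: "\<And>e. e > 0 \<Longrightarrow> eventually (\<lambda>n. \<forall>i\<le>n. \<bar>\<xi> (real i * (T / real n)) - Y n i\<bar> \<le> e) sequentially"
  shows "(\<lambda>n. T / real n * (\<Sum>i<n. \<phi> (Y n i))) \<longlonglongrightarrow> integral {0..T} (\<lambda>s. \<phi> (\<xi> s))"
proof (rule tendstoI)
  fix e :: real assume "e > 0"
  obtain K where K: "K > 0" "\<And>t. t \<in> {0..T} \<Longrightarrow> \<bar>\<xi> t\<bar> \<le> K"
    and uc: "\<And>e. e > 0 \<Longrightarrow> \<exists>d>0. \<forall>s\<in>{0..T}. \<forall>t\<in>{0..T}. \<bar>s - t\<bar> < d \<longrightarrow> \<bar>\<xi> s - \<xi> t\<bar> < e"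
    using path_bounded_uniform[OF \<xi>(1)] by metis
  have "continuous_on {-(K+1)..K+1} \<phi>" using \<phi> by (rule continuous_on_subset) auto
  from compact_uniformly_continuous[OF this compact_Icc]
  obtain r where r: "r > 0" "\<And>u v. u \<in> {-(K+1)..K+1} \<Longrightarrow> v \<in> {-(K+1)..K+1} \<Longrightarrow> \<bar>u - v\<bar> < r \<Longrightarrow> \<bar>\<phi> u - \<phi> v\<bar> < e / (2 * T)"
    unfolding uniformly_continuous_on_def dist_real_def
    using \<open>e > 0\<close> T by (metis divide_pos_pos zero_less_mult_iff zero_less_numeral)
  \<comment> \<open>Path oscillation and scheme error are at most \<open>r'\<close> each, so their
    sum stays below \<open>r\<close>; the cap at one keeps all arguments of \<open>\<phi>\<close>
    within \<open>{-(K+1)..K+1}\<close>.\<close>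
  define r' where "r' = min (r / 3) 1"
  have r': "r' > 0" "r' \<le> 1" "2 * r' < r" using r(1) by (auto simp: r'_def)
  obtain d where d: "d > 0" "\<And>s t. s \<in> {0..T} \<Longrightarrow> t \<in> {0..T} \<Longrightarrow> \<bar>s - t\<bar> < d \<Longrightarrow> \<bar>\<xi> s - \<xi> t\<bar> < r'"
    using uc[OF r'(1)] by blast
  show "eventually (\<lambda>n. dist (T / real n * (\<Sum>i<n. \<phi> (Y n i))) (integral {0..T} (\<lambda>s. \<phi> (\<xi> s))) < e) sequentially"
    using eventually_step_less[OF d(1), of T] eventually_gt_at_top[of 0] Y[OF r'(1)]
  proof eventually_elim
    case (elim n)
    define h where "h = T / real n"
    have h: "h > 0" "real n * h = T" "h < d" using elim T by (auto simp: h_def)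
    have grid: "real i * h \<in> {0..T}" if "i \<le> n" for i
      using that h by (auto simp flip: h(2) intro!: mult_right_mono)
    have cont: "continuous_on {0..} (\<lambda>s. \<phi> (\<xi> s))"
      by (rule continuous_on_compose2[OF \<phi> \<xi>(1)]) auto
    have cell: "\<bar>integral {real i * h..real (Suc i) * h} (\<lambda>s. \<phi> (\<xi> s)) - h * \<phi> (Y n i)\<bar> \<le> h * (e / (2 * T))"
      if "i < n" for i
    proof -
      have g: "real i * h \<in> {0..T}" "real (Suc i) * h \<in> {0..T}" using grid[of i] grid[of "Suc i"] that by auto
      have le: "real i * h \<le> real (Suc i) * h" using h by simp
      have sub: "{real i * h..real (Suc i) * h} \<subseteq> {0..T}" using g by auto
      have Yi: "\<bar>\<xi> (real i * h) - Y n i\<bar> \<le> r'" using elim(3) that by (simp add: h_def)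
      have "\<bar>integral {real i * h..real (Suc i) * h} (\<lambda>s. \<phi> (\<xi> s)) - (real (Suc i) * h - real i * h) * \<phi> (Y n i)\<bar>
        \<le> (real (Suc i) * h - real i * h) * (e / (2 * T))"
      proof (rule abs_integral_sub_le[OF le])
        show "continuous_on {real i * h..real (Suc i) * h} (\<lambda>s. \<phi> (\<xi> s))"
          using cont sub by (auto intro: continuous_on_subset)
        fix s assume s: "s \<in> {real i * h..real (Suc i) * h}"
        then have sT: "s \<in> {0..T}" using sub by blast
        have "\<bar>s - real i * h\<bar> < d" using s h by (auto simp: field_simps)
        then have "\<bar>\<xi> s - \<xi> (real i * h)\<bar> < r'" using d(2) g sT by blast
        then have "\<bar>\<xi> s - Y n i\<bar> < r" using Yi r' by linarith
        moreover have "\<bar>\<xi> s\<bar> \<le> K" "\<bar>\<xi> (real i * h)\<bar> \<le> K" using K(2) sT g by blast+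
        ultimately show "\<bar>\<phi> (\<xi> s) - \<phi> (Y n i)\<bar> \<le> e / (2 * T)"
          using Yi r' by (intro less_imp_le r(2)) (auto simp: abs_le_iff)
      qed
      then show ?thesis by (simp add: algebra_simps)
    qed
    have "\<bar>integral {0..T} (\<lambda>s. \<phi> (\<xi> s)) - h * (\<Sum>i<n. \<phi> (Y n i))\<bar>
       = \<bar>\<Sum>i<n. integral {real i * h..real (Suc i) * h} (\<lambda>s. \<phi> (\<xi> s)) - h * \<phi> (Y n i)\<bar>"
      using integral_grid[of h _ n, OF _ cont] h by (simp add: sum_subtractf sum_distrib_left)
    also have "\<dots> \<le> (\<Sum>i<n. h * (e / (2 * T)))"
      by (intro order_trans[OF sum_abs] sum_mono cell) simp
    also have "\<dots> = e / 2" using h T by (simp add: field_simps)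
    also have "\<dots> < e" using \<open>e > 0\<close> by simp
    finally show ?case by (simp add: dist_real_def h_def abs_minus_commute)
  qed
qed

section \<open>The Euler scheme of the stochastic differential equation\<close>

lemma gaussian_steps_brownian:
  assumes W: "standard_brownian_motion M W" and "\<sigma> > 0" "h > 0" "n > 0"
  shows "gaussian_steps M (\<lambda>i \<omega>. \<sigma> * (W (real (Suc i) * h) \<omega> - W (real i * h) \<omega>)) n (\<sigma> * sqrt h)"
proof -
  interpret prob_space M using W by (simp add: standard_brownian_motion_def)
  show ?thesis
  proof unfold_locales
    have "incseq (\<lambda>i. real i * h)" using assms by (auto intro!: monoI mult_right_mono)
    then have "indep_vars (\<lambda>_. borel) (\<lambda>i \<omega>. W (real (Suc i) * h) \<omega> - W (real i * h) \<omega>) {..<n}"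
      using W unfolding standard_brownian_motion_def by (auto dest!: spec[of _ n] spec[of _ "\<lambda>i. real i * h"])
    then show "indep_vars (\<lambda>_. borel) (\<lambda>i \<omega>. \<sigma> * (W (real (Suc i) * h) \<omega> - W (real i * h) \<omega>)) {..<n}"
      by (rule indep_vars_compose2) simp
    fix i
    have "0 \<le> real i * h" "real i * h < real (Suc i) * h" using assms by auto
    then have "distributed M lborel (\<lambda>\<omega>. W (real (Suc i) * h) \<omega> - W (real i * h) \<omega>)
        (normal_density 0 (sqrt (real (Suc i) * h - real i * h)))"
      using W unfolding standard_brownian_motion_def by blast
    moreover have "real (Suc i) * h - real i * h = h" by (simp add: algebra_simps)
    ultimately have d: "distributed M lborel (\<lambda>\<omega>. W (real (Suc i) * h) \<omega> - W (real i * h) \<omega>) (normal_density 0 (sqrt h))"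
      by metis
    show "distributed M lborel (\<lambda>\<omega>. \<sigma> * (W (real (Suc i) * h) \<omega> - W (real i * h) \<omega>)) (normal_density 0 (\<sigma> * sqrt h))"
      using normal_density_affine[OF d, of \<sigma> 0] assms by simp
  qed (use assms in auto)
qed

locale sde = prob_space M for M :: "'a measure" +
  fixes W X :: "real \<Rightarrow> 'a \<Rightarrow> real" and b L :: "real \<Rightarrow> real" and \<sigma> \<theta> x :: real
  assumes W: "standard_brownian_motion M W" and \<sigma>: "\<sigma> > 0"
    and b: "b \<in> drift_class" and b_\<theta>: "b \<theta> = 0"
    and L: "\<And>y. (L has_real_derivative b y) (at y)" and L_le: "\<And>y. L y \<le> L \<theta>"
    and X: "strong_solution M W b \<sigma> x X"
begin

definition Z :: "real \<Rightarrow> nat \<Rightarrow> nat \<Rightarrow> 'a \<Rightarrow> real" where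
  "Z T n i \<omega> = \<sigma> * (W (real (Suc i) * (T / real n)) \<omega> - W (real i * (T / real n)) \<omega>)"

definition Y :: "real \<Rightarrow> nat \<Rightarrow> 'a \<Rightarrow> nat \<Rightarrow> real" where
  "Y T n \<omega> = walk (\<lambda>_ y. T / real n * b y) x (\<lambda>i. Z T n i \<omega>)"

definition B :: "real \<Rightarrow> nat \<Rightarrow> 'a \<Rightarrow> nat \<Rightarrow> real" where
  "B T n \<omega> = walk (\<lambda>_ _. 0) x (\<lambda>i. Z T n i \<omega>)"

text \<open>The left-endpoint Riemann sum for the integral in the Novikov functional, with the Euler
  scheme in place of the solution.\<close>

definition energy :: "real \<Rightarrow> nat \<Rightarrow> 'a \<Rightarrow> real" where
  "energy T n \<omega> = T / real n * (\<Sum>i<n. (b (Y T n \<omega> i))\<^sup>2 / \<sigma>\<^sup>2)"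

lemma gaussian_steps_Z: "T > 0 \<Longrightarrow> n > 0 \<Longrightarrow> gaussian_steps M (Z T n) n (\<sigma> * sqrt (T / real n))"
  using gaussian_steps_brownian[OF W \<sigma>, of "T / real n" n] by (simp add: Z_def[abs_def] del: of_nat_Suc)

lemma sum_Z: "(\<Sum>j<i. Z T n j \<omega>) = \<sigma> * (W (real i * (T / real n)) \<omega> - W 0 \<omega>)"
  by (induction i) (auto simp: Z_def algebra_simps)

text \<open>The term \<open>W 0\<close> remains because it vanishes only almost surely, whereas this
  identity holds at every sample point.\<close>

lemma B_eq: "B T n \<omega> i = x + \<sigma> * (W (real i * (T / real n)) \<omega> - W 0 \<omega>)"
  by (simp only: B_def walk_zero sum_Z)

lemma B_Suc: "B T n \<omega> (Suc i) - B T n \<omega> i = Z T n i \<omega>"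
  by (simp add: B_def)

lemma measurable_W: "t \<ge> 0 \<Longrightarrow> W t \<in> borel_measurable M"
  using W by (simp add: standard_brownian_motion_def)

lemma measurable_Z: "T \<ge> 0 \<Longrightarrow> Z T n i \<in> borel_measurable M"
  using measurable_W[of "real (Suc i) * (T / real n)"] measurable_W[of "real i * (T / real n)"]
  unfolding Z_def[abs_def] by simp

lemma measurable_b [measurable]: "b \<in> borel_measurable borel"
  using continuous_on_drift[OF b] by (rule borel_measurable_continuous_onI)

lemma measurable_Y: "T \<ge> 0 \<Longrightarrow> (\<lambda>\<omega>. Y T n \<omega> i) \<in> borel_measurable M"
  unfolding Y_def by (rule measurable_walk) (auto intro: measurable_Z)

lemma measurable_B: "T \<ge> 0 \<Longrightarrow> (\<lambda>\<omega>. B T n \<omega> i) \<in> borel_measurable M"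
  unfolding B_def by (rule measurable_walk) (auto intro: measurable_Z)

text \<open>Continuity of the paths makes the Lebesgue integral in the equation a gauge integral,
  the form in which the deterministic convergence results are stated.\<close>

lemma AE_solution:
  "AE \<omega> in M. continuous_on {0..} (\<lambda>t. X t \<omega>) \<and> X 0 \<omega> = x \<and>
     (\<forall>t\<ge>0. X t \<omega> = x + integral {0..t} (\<lambda>s. b (X s \<omega>)) + \<sigma> * W t \<omega>)"
proof -
  have "AE \<omega> in M. continuous_on {0..} (\<lambda>t. X t \<omega>)" "AE \<omega> in M. X 0 \<omega> = x"
     "AE \<omega> in M. \<forall>t\<ge>0. X t \<omega> = x + (LBINT s:{0..t}. b (X s \<omega>)) + \<sigma> * W t \<omega>"
    using X by (auto simp: strong_solution_def)
  then show ?thesis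
  proof eventually_elim
    case (elim \<omega>)
    have I: "(LBINT s:{0..t}. b (X s \<omega>)) = integral {0..t} (\<lambda>s. b (X s \<omega>))" for t
    proof (rule set_borel_integral_eq_integral(2)[OF borel_integrable_atLeastAtMost'])
      show "continuous_on {0..t} (\<lambda>s. b (X s \<omega>))"
        by (rule continuous_on_compose2[OF continuous_on_drift[OF b] continuous_on_subset[OF elim(1)]]) auto
    qed
    then show ?case using elim unfolding I by blast
  qed
qed

lemma continuous_integrand:
  assumes "continuous_on {0..} (\<lambda>t. X t \<omega>)"
  shows "continuous_on {0..T} (\<lambda>s. (b (X s \<omega>))\<^sup>2 / \<sigma>\<^sup>2)"
  using \<sigma> by (intro continuous_intros continuous_on_compose2[OF continuous_on_drift[OF b] continuous_on_subset[OF assms]]) auto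

text \<open>Almost every path satisfies the hypotheses of the deterministic convergence results,
  with noise \<open>\<sigma> * W t\<close>; the energy converges as a Riemann sum.\<close>

lemma AE_euler:
  assumes T: "T > 0"
  shows "AE \<omega> in M. continuous_on {0..} (\<lambda>t. X t \<omega>) \<and>
    (\<forall>e>0. \<forall>\<^sub>F n in sequentially. \<forall>i\<le>n. \<bar>X (real i * (T / real n)) \<omega> - Y T n \<omega> i\<bar> \<le> e) \<and>
    (\<lambda>n. energy T n \<omega>) \<longlonglongrightarrow> (LBINT s:{0..T}. (b (X s \<omega>))\<^sup>2 / \<sigma>\<^sup>2)"
  using AE_solution
proof eventually_elim
  case (elim \<omega>)
  then have cont: "continuous_on {0..} (\<lambda>t. X t \<omega>)" by simp
  have Z: "Z T n i \<omega> = \<sigma> * W (real (Suc i) * (T / real n)) \<omega> - \<sigma> * W (real i * (T / real n)) \<omega>" for n i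
    by (simp add: Z_def algebra_simps)
  have Y: "\<forall>\<^sub>F n in sequentially. \<forall>i\<le>n. \<bar>X (real i * (T / real n)) \<omega> - Y T n \<omega> i\<bar> \<le> e" if "e > 0" for e
    unfolding Y_def Z
    by (rule euler_converges[OF b T cont _ _ that, where w="\<lambda>t. \<sigma> * W t \<omega>"]) (use elim in auto)
  have "(LBINT s:{0..T}. (b (X s \<omega>))\<^sup>2 / \<sigma>\<^sup>2) = integral {0..T} (\<lambda>s. (b (X s \<omega>))\<^sup>2 / \<sigma>\<^sup>2)"
    using continuous_integrand[OF cont]
    by (rule set_borel_integral_eq_integral(2)[OF borel_integrable_atLeastAtMost'])
  moreover have "(\<lambda>n. energy T n \<omega>) \<longlonglongrightarrow> integral {0..T} (\<lambda>s. (b (X s \<omega>))\<^sup>2 / \<sigma>\<^sup>2)"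
    unfolding energy_def
    by (rule riemann_sum_converges[OF T cont _ Y, where \<phi>="\<lambda>y. (b y)\<^sup>2 / \<sigma>\<^sup>2"])
      (use \<sigma> in \<open>auto intro!: continuous_intros continuous_on_drift[OF b]\<close>)
  ultimately have "(\<lambda>n. energy T n \<omega>) \<longlonglongrightarrow> (LBINT s:{0..T}. (b (X s \<omega>))\<^sup>2 / \<sigma>\<^sup>2)"
    by (simp only:)
  with cont Y show ?case by blast
qed

lemma measurable_energy: "T \<ge> 0 \<Longrightarrow> (\<lambda>\<omega>. energy T n \<omega>) \<in> borel_measurable M"
  unfolding energy_def
  by (intro borel_measurable_times borel_measurable_const borel_measurable_sum borel_measurable_divide
      borel_measurable_power measurable_compose[OF measurable_Y measurable_b])

text \<open>For the displacement \<open>h * b y\<close> and the step variance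
  \<open>\<sigma>\<^sup>2 * h\<close>, the quadratic part of the shift density is exactly minus half
  the energy. The weight one half in the Novikov functional is the one for which the two cancel,
  leaving a discrete stochastic integral along \<open>B\<close>.\<close>

lemma euler_girsanov:
  assumes T: "T > 0" and n: "n > 0"
    and G[measurable]: "\<And>i. Measurable.pred (borel \<Otimes>\<^sub>M borel) (case_prod (G i))"
  shows "(\<integral>\<^sup>+\<omega>. (if \<forall>i<n. G i (Y T n \<omega> i) (Y T n \<omega> (Suc i))
            then ennreal (exp (1/2 * energy T n \<omega>)) else 0) \<partial>M)
    = (\<integral>\<^sup>+\<omega>. (if \<forall>i<n. G i (B T n \<omega> i) (B T n \<omega> (Suc i))
            then ennreal (exp (\<Sum>i<n. b (B T n \<omega> i) * Z T n i \<omega> / \<sigma>\<^sup>2)) else 0) \<partial>M)"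
proof -
  define h where "h = T / real n"
  have h: "h > 0" using T n by (simp add: h_def)
  interpret gaussian_steps M "Z T n" n "\<sigma> * sqrt h"
    using gaussian_steps_Z[OF T n] by (simp add: h_def)
  let ?A = "\<lambda>(i::nat) y (y'::real). 1/2 * (h * ((b y)\<^sup>2 / \<sigma>\<^sup>2))"
  have Y: "walk (\<lambda>_ y. h * b y) x (\<lambda>j. Z T n j \<omega>) = Y T n \<omega>" for \<omega> by (simp add: Y_def h_def)
  have B: "walk (\<lambda>_ _. 0) x (\<lambda>j. Z T n j \<omega>) = B T n \<omega>" for \<omega> by (simp add: B_def)
  have 1: "(\<Sum>i<n. 1/2 * (h * ((b (Y T n \<omega> i))\<^sup>2 / \<sigma>\<^sup>2))) = 1/2 * energy T n \<omega>" for \<omega>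
    unfolding energy_def h_def by (simp only: sum_distrib_left)
  have 2: "1/2 * (h * ((b y)\<^sup>2 / \<sigma>\<^sup>2)) + (h * b y * v - (h * b y)\<^sup>2 / 2) / (\<sigma> * sqrt h)\<^sup>2 = b y * v / \<sigma>\<^sup>2" for y v
    using h \<sigma> by (simp add: power_mult_distrib field_simps power2_eq_square)
  have m: "(\<lambda>y. h * b y) \<in> borel_measurable borel"
    "case_prod (?A i) \<in> borel_measurable (borel \<Otimes>\<^sub>M borel)" for i by measurable
  show ?thesis
    using discrete_girsanov[of "\<lambda>_ y. h * b y" G ?A x, OF m(1) G m(2)]
    unfolding Y B B_Suc 1 2 .
qed

end

section \<open>Subquadratic drifts\<close>

text \<open>The growth condition gives the quadratic term outside a bounded interval;
  \<open>C\<close> bounds the continuous slope inside it.\<close>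

lemma neg_slope_subquadratic_bound:
  assumes b: "b \<in> drift_class" and o: "(\<lambda>y. neg_slope b (\<theta> + y)) \<in> o[at_infinity](\<lambda>y. y\<^sup>2)"
    and "\<epsilon> > 0"
  obtains C where "C \<ge> 0" "\<And>v. neg_slope b v \<le> \<epsilon> * (v - \<theta>)\<^sup>2 + C"
proof -
  have "eventually (\<lambda>y. norm (neg_slope b (\<theta> + y)) \<le> \<epsilon> * norm (y\<^sup>2)) at_infinity"
    using o \<open>\<epsilon> > 0\<close> by (rule landau_o.smallD)
  then obtain r where r: "\<And>y. norm y \<ge> r \<Longrightarrow> norm (neg_slope b (\<theta> + y)) \<le> \<epsilon> * norm (y\<^sup>2)"
    unfolding eventually_at_infinity by blast
  have "continuous_on {\<theta> - r..\<theta> + r} (deriv b)"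
    using continuous_on_deriv_drift[OF b] by (rule continuous_on_subset) auto
  from compact_imp_bounded[OF compact_continuous_image[OF this compact_Icc]]
  obtain C where C: "C > 0" "\<And>v. v \<in> {\<theta> - r..\<theta> + r} \<Longrightarrow> \<bar>deriv b v\<bar> \<le> C"
    by (auto simp: bounded_pos)
  have "neg_slope b v \<le> \<epsilon> * (v - \<theta>)\<^sup>2 + C" for v
  proof (cases "\<bar>v - \<theta>\<bar> \<ge> r")
    case True
    then show ?thesis using r[of "v - \<theta>"] C(1) by simp
  next
    case False
    then have "v \<in> {\<theta> - r..\<theta> + r}" by auto
    moreover have "0 \<le> \<epsilon> * (v - \<theta>)\<^sup>2" using \<open>\<epsilon> > 0\<close> by simp
    ultimately show ?thesis using C(2)[of v] unfolding neg_slope_def by linarith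
  qed
  then show ?thesis using C(1) by (intro that[of C]) auto
qed

text \<open>Jensen's inequality with uniform weights. It replaces the exponential of a time average
  by exponentials at single times, so that only one-dimensional laws have to be estimated.\<close>

lemma exp_mean_le_mean_exp:
  fixes u :: "nat \<Rightarrow> real"
  assumes "n > 0"
  shows "exp (1 / real n * (\<Sum>i<n. u i)) \<le> 1 / real n * (\<Sum>i<n. exp (u i))"
  using convex_on_sum[of "{..<n}" UNIV exp "\<lambda>_. 1 / real n" u, OF _ _ exp_convex] assms
  by (auto simp: sum_distrib_left)

section \<open>Uniform bound for truncated Euler functionals and finiteness by Fatou's lemma\<close>

context sde
begin

text \<open>The increment \<open>B T n \<omega> i - x\<close> is centred normal with variance at
  most \<open>\<sigma>\<^sup>2 * T\<close>. The smallness of \<open>\<epsilon>\<close> leaves at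
  least one half under the root in the Gaussian integral.\<close>

lemma nn_integral_exp_square_B_le:
  assumes T: "T > 0" and n: "n > 0" "i < n" and \<epsilon>: "\<epsilon> \<ge> 0" "8 * T\<^sup>2 * \<sigma>\<^sup>2 * \<epsilon> \<le> 1/2"
  shows "(\<integral>\<^sup>+\<omega>. ennreal (exp (4 * T * \<epsilon> * (B T n \<omega> i - x)\<^sup>2)) \<partial>M) \<le> 2"
proof (cases "i = 0")
  \<comment> \<open>At time zero the law is degenerate and has no density; the integrand is
    one.\<close>
  case True
  then show ?thesis by (simp add: B_def emeasure_space_1)
next
  case False
  define t where "t = real i * (T / real n)"
  have t: "0 < t" "t \<le> T" using T n False by (auto simp: t_def field_simps)
  have d: "distributed M lborel (\<lambda>\<omega>. W t \<omega> - W 0 \<omega>) (normal_density 0 (sqrt (t - 0)))"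
    using W t(1) unfolding standard_brownian_motion_def by blast
  then have d: "distributed M lborel (\<lambda>\<omega>. \<sigma> * (W t \<omega> - W 0 \<omega>)) (normal_density 0 (\<sigma> * sqrt t))"
    using normal_density_affine[of "\<lambda>\<omega>. W t \<omega> - W 0 \<omega>" 0 "sqrt t" \<sigma> 0] \<sigma> t by simp
  define s where "s = \<sigma> * sqrt t"
  have s: "s > 0" "s\<^sup>2 = \<sigma>\<^sup>2 * t" using \<sigma> t by (auto simp: s_def power_mult_distrib)
  define a where "a = 4 * T * \<epsilon>"
  have "2 * a * s\<^sup>2 = 8 * T * \<sigma>\<^sup>2 * \<epsilon> * t" using s by (simp add: a_def)
  also have "\<dots> \<le> 8 * T * \<sigma>\<^sup>2 * \<epsilon> * T" using t T \<epsilon> by (intro mult_left_mono) auto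
  also have "\<dots> \<le> 1/2" using \<epsilon> by (simp add: power2_eq_square mult_ac)
  finally have as: "2 * a * s\<^sup>2 \<le> 1/2" .
  have "(\<integral>\<^sup>+\<omega>. ennreal (exp (4 * T * \<epsilon> * (B T n \<omega> i - x)\<^sup>2)) \<partial>M)
     = (\<integral>\<^sup>+\<omega>. ennreal (exp (a * (\<sigma> * (W t \<omega> - W 0 \<omega>))\<^sup>2)) \<partial>M)"
    by (simp add: B_eq t_def a_def)
  also have "\<dots> = (\<integral>\<^sup>+u. ennreal (exp (a * u\<^sup>2)) \<partial>distr M lborel (\<lambda>\<omega>. \<sigma> * (W t \<omega> - W 0 \<omega>)))"
    using distributed_measurable[OF d] by (subst nn_integral_distr) auto
  also have "\<dots> = (\<integral>\<^sup>+u. ennreal (exp (a * u\<^sup>2)) \<partial>gauss s)"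
    unfolding s_def by (simp only: distributed_distr_eq_density[OF d])
  also have "\<dots> = ennreal (1 / sqrt (1 - 2 * a * s\<^sup>2))"
    by (rule nn_integral_gauss_exp_square) (use s as in auto)
  also have "\<dots> \<le> ennreal 2"
  proof (rule ennreal_leI)
    have "1/2 \<le> sqrt (1 - 2 * a * s\<^sup>2)" by (rule real_le_rsqrt) (use as in \<open>simp add: power2_eq_square\<close>)
    then show "1 / sqrt (1 - 2 * a * s\<^sup>2) \<le> 2" using as by (simp add: divide_le_eq)
  qed
  finally show ?thesis by simp
qed

text \<open>The truncation at level \<open>k\<close> makes the coefficient of the squared steps
  bounded, so that \<open>big\<close> gives the smallness needed for the exponential moment of
  squares. The resulting bound contains neither \<open>k\<close> nor \<open>n\<close>, as Fatou's
  lemma requires.\<close>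

lemma truncated_euler_bound:
  assumes T: "T > 0" and n: "n > 0" and k: "k \<ge> 0"
    and \<epsilon>: "\<epsilon> \<ge> 0" "8 * T\<^sup>2 * \<sigma>\<^sup>2 * \<epsilon> \<le> 1/2" and C: "C \<ge> 0"
    and q: "\<And>y v. \<bar>v - y\<bar> \<le> 1 \<Longrightarrow> neg_slope b v \<le> 2 * \<epsilon> * (y - x)\<^sup>2 + C"
    and big: "4 * T * (2 * \<epsilon> * (k + \<bar>x\<bar>)\<^sup>2 + C) \<le> real n"
  shows "(\<integral>\<^sup>+\<omega>. (if \<forall>i<n. \<bar>Y T n \<omega> i\<bar> \<le> k \<and> \<bar>Y T n \<omega> (Suc i) - Y T n \<omega> i\<bar> \<le> 1
            then ennreal (exp (1/2 * energy T n \<omega>)) else 0) \<partial>M)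
       \<le> ennreal (exp ((L \<theta> - L x) / \<sigma>\<^sup>2)) * (1 + ennreal (exp (2 * T * C)) * 2)"
proof -
  define s where "s = \<sigma> * sqrt (T / real n)"
  have s2: "s\<^sup>2 = \<sigma>\<^sup>2 * (T / real n)" using T by (simp add: s_def power_mult_distrib)
  interpret S: gaussian_steps M "Z T n" n s
    using gaussian_steps_Z[OF T n] by (simp add: s_def)
  define g where "g y = 2 * \<epsilon> * (y - x)\<^sup>2 + C" for y
  have g0: "g y \<ge> 0" for y using \<epsilon> C by (simp add: g_def)
  \<comment> \<open>Cutting off at \<open>k\<close> does not change the exponent on the truncated
    event, but makes \<open>2 * \<gamma> y * s\<^sup>2 \<le> 1/2\<close> hold for every
    \<open>y\<close>.\<close>
  define \<gamma> where "\<gamma> y = (if \<bar>y\<bar> \<le> k then g y / \<sigma>\<^sup>2 else 0)" for y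
  have \<gamma>m[measurable]: "\<gamma> \<in> borel_measurable borel" unfolding \<gamma>_def g_def by measurable
  have \<gamma>0: "0 \<le> \<gamma> y" for y using g0 by (simp add: \<gamma>_def)
  have \<gamma>s: "2 * \<gamma> y * s\<^sup>2 \<le> 1/2" for y
  proof (cases "\<bar>y\<bar> \<le> k")
    case True
    have "(y - x)\<^sup>2 \<le> (k + \<bar>x\<bar>)\<^sup>2" by (rule abs_le_square_iff[THEN iffD1]) (use True k in linarith)
    then have "g y \<le> 2 * \<epsilon> * (k + \<bar>x\<bar>)\<^sup>2 + C" using \<epsilon> by (simp add: g_def mult_left_mono)
    then have "4 * T * g y \<le> 4 * T * (2 * \<epsilon> * (k + \<bar>x\<bar>)\<^sup>2 + C)" using T by simp
    then have "4 * T * g y \<le> real n" using big by linarith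
    then show ?thesis using True \<sigma> n by (simp add: \<gamma>_def s2 field_simps)
  qed (simp add: \<gamma>_def)
  let ?c = "exp ((L \<theta> - L x) / \<sigma>\<^sup>2)"
  let ?G = "\<lambda>(i::nat) y y'. \<bar>y\<bar> \<le> k \<and> \<bar>y' - y\<bar> \<le> 1"
  have "(\<integral>\<^sup>+\<omega>. (if \<forall>i<n. ?G i (Y T n \<omega> i) (Y T n \<omega> (Suc i))
            then ennreal (exp (1/2 * energy T n \<omega>)) else 0) \<partial>M)
     = (\<integral>\<^sup>+\<omega>. (if \<forall>i<n. ?G i (B T n \<omega> i) (B T n \<omega> (Suc i))
            then ennreal (exp (\<Sum>i<n. b (B T n \<omega> i) * Z T n i \<omega> / \<sigma>\<^sup>2)) else 0) \<partial>M)"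
    by (rule euler_girsanov[OF T n]) measurable
  also have "\<dots> \<le> (\<integral>\<^sup>+\<omega>. ennreal ?c * ennreal (exp (1/2 * (\<Sum>i<n. \<gamma> (B T n \<omega> i) * (Z T n i \<omega>)\<^sup>2))) \<partial>M)"
  proof (intro nn_integral_mono)
    fix \<omega>
    show "(if \<forall>i<n. ?G i (B T n \<omega> i) (B T n \<omega> (Suc i))
            then ennreal (exp (\<Sum>i<n. b (B T n \<omega> i) * Z T n i \<omega> / \<sigma>\<^sup>2)) else 0)
       \<le> ennreal ?c * ennreal (exp (1/2 * (\<Sum>i<n. \<gamma> (B T n \<omega> i) * (Z T n i \<omega>)\<^sup>2)))"
    proof (cases "\<forall>i<n. ?G i (B T n \<omega> i) (B T n \<omega> (Suc i))")
      case True
      \<comment> \<open>The intermediate point of the expansion lies within distance one of the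
        current position, because the event limits the step size; hence \<open>q\<close> applies to
        it.\<close>
      have step: "b (B T n \<omega> i) * Z T n i \<omega> / \<sigma>\<^sup>2 \<le> (L (B T n \<omega> (Suc i)) - L (B T n \<omega> i)) / \<sigma>\<^sup>2
          + 1/2 * (\<gamma> (B T n \<omega> i) * (Z T n i \<omega>)\<^sup>2)" if "i < n" for i
      proof -
        let ?y = "B T n \<omega> i" and ?y' = "B T n \<omega> (Suc i)"
        obtain v where v: "v \<in> closed_segment ?y ?y'"
          "b ?y * (?y' - ?y) = L ?y' - L ?y + neg_slope b v / 2 * (?y' - ?y)\<^sup>2"
          using drift_taylor[OF b L] by blast
        have i: "\<bar>?y\<bar> \<le> k" "\<bar>?y' - ?y\<bar> \<le> 1" using True that by auto
        have "\<bar>v - ?y\<bar> \<le> 1" using v(1) i(2) by (auto simp: closed_segment_eq_real_ivl split: if_splits)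
        then have "neg_slope b v \<le> g ?y" using q by (simp add: g_def)
        then have "neg_slope b v / 2 * (?y' - ?y)\<^sup>2 \<le> g ?y / 2 * (?y' - ?y)\<^sup>2" by (intro mult_right_mono) auto
        then have "b ?y * Z T n i \<omega> \<le> L ?y' - L ?y + g ?y / 2 * (Z T n i \<omega>)\<^sup>2" using v(2) by (simp add: B_Suc)
        then have "b ?y * Z T n i \<omega> / \<sigma>\<^sup>2 \<le> (L ?y' - L ?y + g ?y / 2 * (Z T n i \<omega>)\<^sup>2) / \<sigma>\<^sup>2"
          by (rule divide_right_mono) simp
        then show ?thesis using i by (simp add: \<gamma>_def add_divide_distrib)
      qed
      have "(\<Sum>i<n. b (B T n \<omega> i) * Z T n i \<omega> / \<sigma>\<^sup>2) \<le>
         (\<Sum>i<n. (L (B T n \<omega> (Suc i)) - L (B T n \<omega> i)) / \<sigma>\<^sup>2 + 1/2 * (\<gamma> (B T n \<omega> i) * (Z T n i \<omega>)\<^sup>2))"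
        by (intro sum_mono step) simp
      also have "\<dots> = (L (B T n \<omega> n) - L (B T n \<omega> 0)) / \<sigma>\<^sup>2 + 1/2 * (\<Sum>i<n. \<gamma> (B T n \<omega> i) * (Z T n i \<omega>)\<^sup>2)"
        unfolding sum.distrib sum_distrib_left[symmetric] sum_divide_distrib[symmetric]
        by (simp only: sum_lessThan_telescope[of "\<lambda>i. L (B T n \<omega> i)"])
      also have "\<dots> \<le> (L \<theta> - L x) / \<sigma>\<^sup>2 + 1/2 * (\<Sum>i<n. \<gamma> (B T n \<omega> i) * (Z T n i \<omega>)\<^sup>2)"
        using L_le by (intro add_right_mono divide_right_mono) (auto simp: B_def)
      finally show ?thesis using True by (simp add: ennreal_mult[symmetric] exp_add[symmetric])
    next
      case False
      then show ?thesis by (subst if_not_P) simp_all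
    qed
  qed
  also have "\<dots> = ennreal ?c * (\<integral>\<^sup>+\<omega>. ennreal (exp (1/2 * (\<Sum>i<n. \<gamma> (B T n \<omega> i) * (Z T n i \<omega>)\<^sup>2))) \<partial>M)"
    using T by (intro nn_integral_cmult measurable_compose[OF _ measurable_ennreal] measurable_compose[OF _ borel_measurable_exp]
        borel_measurable_times borel_measurable_const borel_measurable_sum borel_measurable_power
        measurable_compose[OF measurable_B \<gamma>m] measurable_Z) auto
  also have "\<dots> \<le> ennreal ?c * (1 + (\<integral>\<^sup>+\<omega>. ennreal (exp (2 * s\<^sup>2 * (\<Sum>i<n. \<gamma> (B T n \<omega> i)))) \<partial>M))"
    unfolding B_def by (intro mult_left_mono S.nn_integral_exp_squares_le \<gamma>m \<gamma>0 \<gamma>s) simp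
  also have "\<dots> \<le> ennreal ?c * (1 + ennreal (exp (2 * T * C)) * 2)"
  proof (intro mult_left_mono add_left_mono)
    \<comment> \<open>As \<open>s\<^sup>2 = \<sigma>\<^sup>2 * (T / real n)\<close>, the exponent is
      at most the mean of \<open>2 * T * g\<close> over the grid, to which Jensen's inequality
      applies.\<close>
    have le: "exp (2 * s\<^sup>2 * (\<Sum>i<n. \<gamma> (B T n \<omega> i)))
       \<le> exp (2 * T * C) / real n * (\<Sum>i<n. exp (4 * T * \<epsilon> * (B T n \<omega> i - x)\<^sup>2))" for \<omega>
    proof -
      have "2 * s\<^sup>2 * \<gamma> y \<le> 1 / real n * (2 * T * g y)" for y
        using T g0[of y] \<sigma> by (auto simp: \<gamma>_def s2)
      then have "2 * s\<^sup>2 * (\<Sum>i<n. \<gamma> (B T n \<omega> i)) \<le> 1 / real n * (\<Sum>i<n. 2 * T * g (B T n \<omega> i))"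
        by (simp only: sum_distrib_left sum_mono)
      then have "exp (2 * s\<^sup>2 * (\<Sum>i<n. \<gamma> (B T n \<omega> i))) \<le> exp (1 / real n * (\<Sum>i<n. 2 * T * g (B T n \<omega> i)))" by simp
      also have "\<dots> \<le> 1 / real n * (\<Sum>i<n. exp (2 * T * g (B T n \<omega> i)))" by (rule exp_mean_le_mean_exp[OF n])
      also have "\<dots> = exp (2 * T * C) / real n * (\<Sum>i<n. exp (4 * T * \<epsilon> * (B T n \<omega> i - x)\<^sup>2))"
      proof -
        have "exp (2 * T * g y) = exp (2 * T * C) * exp (4 * T * \<epsilon> * (y - x)\<^sup>2)" for y
          by (simp add: g_def exp_add[symmetric] algebra_simps)
        then show ?thesis by (simp add: sum_distrib_left)
      qed
      finally show ?thesis .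
    qed
    have m: "(\<lambda>\<omega>. ennreal (exp (4 * T * \<epsilon> * (B T n \<omega> i - x)\<^sup>2))) \<in> borel_measurable M" for i
      using measurable_B[of T n i] T by simp
    have "(\<integral>\<^sup>+\<omega>. ennreal (exp (2 * s\<^sup>2 * (\<Sum>i<n. \<gamma> (B T n \<omega> i)))) \<partial>M)
       \<le> (\<integral>\<^sup>+\<omega>. ennreal (exp (2 * T * C) / real n) * (\<Sum>i<n. ennreal (exp (4 * T * \<epsilon> * (B T n \<omega> i - x)\<^sup>2))) \<partial>M)"
      using le by (intro nn_integral_mono) (simp add: sum_ennreal ennreal_mult[symmetric] sum_nonneg)
    also have "\<dots> = ennreal (exp (2 * T * C) / real n) * (\<Sum>i<n. \<integral>\<^sup>+\<omega>. ennreal (exp (4 * T * \<epsilon> * (B T n \<omega> i - x)\<^sup>2)) \<partial>M)"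
      by (subst nn_integral_cmult, intro borel_measurable_sum m, subst nn_integral_sum, rule m, rule refl)
    also have "\<dots> \<le> ennreal (exp (2 * T * C) / real n) * (\<Sum>i<n. 2)"
      by (intro mult_left_mono sum_mono nn_integral_exp_square_B_le T n \<epsilon>) auto
    also have "\<dots> = ennreal (exp (2 * T * C)) * 2"
    proof -
      have "(\<Sum>i<n. 2) = ennreal (real n * 2)" by (simp add: ennreal_mult ennreal_of_nat_eq_real_of_nat)
      then have "ennreal (exp (2 * T * C) / real n) * (\<Sum>i<n. 2) = ennreal (exp (2 * T * C) / real n * (real n * 2))"
        by (simp only: ennreal_mult[symmetric]) (simp add: ennreal_mult[symmetric])
      also have "exp (2 * T * C) / real n * (real n * 2) = exp (2 * T * C) * 2" using n by simp
      finally show ?thesis by (simp add: ennreal_mult)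
    qed
    finally show "(\<integral>\<^sup>+\<omega>. ennreal (exp (2 * s\<^sup>2 * (\<Sum>i<n. \<gamma> (B T n \<omega> i)))) \<partial>M) \<le> ennreal (exp (2 * T * C)) * 2" .
  qed simp
  finally show ?thesis .
qed

text \<open>The truncation level grows along a sequence of ever finer grids. On almost every path
  the truncation is eventually inactive, so the limit of the truncated functionals is the Novikov
  integrand, and Fatou's lemma transfers the uniform bound.\<close>

lemma novikov_half_finite:
  assumes T: "T > 0" and o: "(\<lambda>y. neg_slope b (\<theta> + y)) \<in> o[at_infinity](\<lambda>y. y\<^sup>2)"
  shows "novikov_half M b \<sigma> X T < \<infinity>"
proof -
  \<comment> \<open>This value turns the condition on
    \<open>8 * T\<^sup>2 * \<sigma>\<^sup>2 * \<epsilon>\<close> into an equality.\<close>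
  define \<epsilon> where "\<epsilon> = 1 / (16 * T\<^sup>2 * \<sigma>\<^sup>2)"
  have \<epsilon>: "\<epsilon> > 0" "8 * T\<^sup>2 * \<sigma>\<^sup>2 * \<epsilon> \<le> 1/2" using T \<sigma> by (auto simp: \<epsilon>_def)
  obtain C0 where C0: "C0 \<ge> 0" "\<And>v. neg_slope b v \<le> \<epsilon> * (v - \<theta>)\<^sup>2 + C0"
    using neg_slope_subquadratic_bound[OF b o \<epsilon>(1)] by blast
  define d where "d = 1 + \<bar>x - \<theta>\<bar>"
  \<comment> \<open>Passing from \<open>v\<close> and centre \<theta> to \<open>y\<close> and centre
    \<open>x\<close> moves the distance by at most \<open>d\<close>; squaring the sum doubles
    \<open>\<epsilon>\<close> and adds \<open>2 * \<epsilon> * d\<^sup>2\<close>.\<close>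
  define C where "C = C0 + 2 * \<epsilon> * d\<^sup>2"
  have C: "C \<ge> 0" using C0 \<epsilon> by (simp add: C_def)
  have q: "neg_slope b v \<le> 2 * \<epsilon> * (y - x)\<^sup>2 + C" if "\<bar>v - y\<bar> \<le> 1" for y v
  proof -
    have "(v - \<theta>)\<^sup>2 \<le> (\<bar>y - x\<bar> + d)\<^sup>2"
      by (rule abs_le_square_iff[THEN iffD1]) (use that in \<open>simp add: d_def\<close>)
    also have "\<dots> \<le> 2 * (y - x)\<^sup>2 + 2 * d\<^sup>2"
      using sum_squares_bound[of "\<bar>y - x\<bar>" d] by (simp add: power2_sum)
    finally have "\<epsilon> * (v - \<theta>)\<^sup>2 \<le> \<epsilon> * (2 * (y - x)\<^sup>2 + 2 * d\<^sup>2)" using \<epsilon> by simp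
    then show ?thesis using C0(2)[of v] by (simp add: C_def algebra_simps)
  qed
  \<comment> \<open>The grid size exceeds the threshold that truncation level \<open>k\<close>
    demands; the summand \<open>k\<close> makes it tend to infinity, and the final one makes it
    positive.\<close>
  define N where "N k = nat \<lceil>4 * T * (2 * \<epsilon> * (real k + \<bar>x\<bar>)\<^sup>2 + C)\<rceil> + k + 1" for k
  have N: "N k > 0" "k \<le> N k" "4 * T * (2 * \<epsilon> * (real k + \<bar>x\<bar>)\<^sup>2 + C) \<le> real (N k)" for k
  proof -
    show "4 * T * (2 * \<epsilon> * (real k + \<bar>x\<bar>)\<^sup>2 + C) \<le> real (N k)"
      using real_nat_ceiling_ge[of "4 * T * (2 * \<epsilon> * (real k + \<bar>x\<bar>)\<^sup>2 + C)"] by (simp add: N_def)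
  qed (auto simp: N_def)
  have Nlim: "filterlim N at_top sequentially"
    by (rule filterlim_at_top_mono[OF filterlim_ident]) (simp add: N)
  define f where "f k \<omega> = (if \<forall>i<N k. \<bar>Y T (N k) \<omega> i\<bar> \<le> real k \<and> \<bar>Y T (N k) \<omega> (Suc i) - Y T (N k) \<omega> i\<bar> \<le> 1
            then ennreal (exp (1/2 * energy T (N k) \<omega>)) else 0)" for k \<omega>
  have f[measurable]: "f k \<in> borel_measurable M" for k
  proof -
    have [measurable]: "(\<lambda>\<omega>. Y T (N k) \<omega> i) \<in> borel_measurable M" "(\<lambda>\<omega>. energy T (N k) \<omega>) \<in> borel_measurable M" for i
      using measurable_Y measurable_energy T by auto
    show ?thesis unfolding f_def[abs_def] by measurable
  qed
  have "AE \<omega> in M. ennreal (exp (1/2 * (LBINT s:{0..T}. (b (X s \<omega>))\<^sup>2 / \<sigma>\<^sup>2))) = liminf (\<lambda>k. f k \<omega>)"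
    using AE_euler[OF T]
  proof eventually_elim
    case (elim \<omega>)
    then have *: "\<forall>e>0. \<forall>\<^sub>F n in sequentially. \<forall>i\<le>n. \<bar>X (real i * (T / real n)) \<omega> - Y T n \<omega> i\<bar> \<le> e" by blast
    \<comment> \<open>A step of the scheme consists of two scheme errors and one increment of the
      path; one third for each keeps it at most one.\<close>
    have conv: "\<forall>\<^sub>F n in sequentially. \<forall>i\<le>n. \<bar>X (real i * (T / real n)) \<omega> - Y T n \<omega> i\<bar> \<le> 1/3"
      by (rule mp[OF spec[OF *]]) simp
    obtain K where K: "K > 0" "\<And>t. t \<in> {0..T} \<Longrightarrow> \<bar>X t \<omega>\<bar> \<le> K"
      and uc: "\<And>e. e > 0 \<Longrightarrow> \<exists>d>0. \<forall>s\<in>{0..T}. \<forall>t\<in>{0..T}. \<bar>s - t\<bar> < d \<longrightarrow> \<bar>X s \<omega> - X t \<omega>\<bar> < e"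
      by (rule path_bounded_uniform[OF conjunct1[OF elim], of T]) (rule that)
    obtain d where d: "d > 0" "\<And>s t. s \<in> {0..T} \<Longrightarrow> t \<in> {0..T} \<Longrightarrow> \<bar>s - t\<bar> < d \<Longrightarrow> \<bar>X s \<omega> - X t \<omega>\<bar> < 1/3"
      using uc[of "1/3"] by auto
    have "\<forall>\<^sub>F n in sequentially. \<forall>i<n. \<bar>Y T n \<omega> i\<bar> \<le> K + 1 \<and> \<bar>Y T n \<omega> (Suc i) - Y T n \<omega> i\<bar> \<le> 1"
      using conv eventually_step_less[OF d(1), of T] eventually_gt_at_top[of 0]
    proof eventually_elim
      case (elim n)
      show ?case
      proof (intro allI impI)
        fix i assume i: "i < n"
        have g: "real i * (T / real n) \<in> {0..T}" "real (Suc i) * (T / real n) \<in> {0..T}"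
          using T i by (auto simp: field_simps simp flip: of_nat_Suc)
        have "\<bar>real (Suc i) * (T / real n) - real i * (T / real n)\<bar> < d"
        proof -
          have "real (Suc i) * h - real i * h = h" for h by (simp add: algebra_simps)
          then show ?thesis using elim T by (simp only:) simp
        qed
        note d(2)[OF g(2) g(1) this] K(2)[OF g(1)]
        moreover have "\<bar>X (real i * (T / real n)) \<omega> - Y T n \<omega> i\<bar> \<le> 1/3"
          "\<bar>X (real (Suc i) * (T / real n)) \<omega> - Y T n \<omega> (Suc i)\<bar> \<le> 1/3" 
          by (rule elim(1)[rule_format], use i in simp)+
        ultimately show "\<bar>Y T n \<omega> i\<bar> \<le> K + 1 \<and> \<bar>Y T n \<omega> (Suc i) - Y T n \<omega> i\<bar> \<le> 1" by linarith
      qed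
    qed
    then have "\<forall>\<^sub>F k in sequentially. \<forall>i<N k. \<bar>Y T (N k) \<omega> i\<bar> \<le> K + 1 \<and> \<bar>Y T (N k) \<omega> (Suc i) - Y T (N k) \<omega> i\<bar> \<le> 1"
      by (rule eventually_compose_filterlim[OF _ Nlim])
    moreover have "\<forall>\<^sub>F k in sequentially. real k \<ge> K + 1"
      using filterlim_real_sequentially unfolding filterlim_at_top by blast
    ultimately have "\<forall>\<^sub>F k in sequentially. ennreal (exp (1/2 * energy T (N k) \<omega>)) = f k \<omega>"
    proof eventually_elim
      case (elim k)
      then have P: "\<forall>i<N k. \<bar>Y T (N k) \<omega> i\<bar> \<le> real k \<and> \<bar>Y T (N k) \<omega> (Suc i) - Y T (N k) \<omega> i\<bar> \<le> 1"
        using order_trans by blast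
      show ?case unfolding f_def if_P[OF P] ..
    qed
    moreover have "(\<lambda>k. ennreal (exp (1/2 * energy T (N k) \<omega>)))
        \<longlonglongrightarrow> ennreal (exp (1/2 * (LBINT s:{0..T}. (b (X s \<omega>))\<^sup>2 / \<sigma>\<^sup>2)))"
      using elim by (intro tendsto_intros tendsto_ennrealI filterlim_compose[OF _ Nlim]) auto
    ultimately have "(\<lambda>k. f k \<omega>) \<longlonglongrightarrow> ennreal (exp (1/2 * (LBINT s:{0..T}. (b (X s \<omega>))\<^sup>2 / \<sigma>\<^sup>2)))"
      by (rule Lim_transform_eventually[rotated])
    then show ?case by (simp add: lim_imp_Liminf)
  qed
  then have "novikov_half M b \<sigma> X T = (\<integral>\<^sup>+\<omega>. liminf (\<lambda>k. f k \<omega>) \<partial>M)"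
    unfolding novikov_half_def by (rule nn_integral_cong_AE)
  also have "\<dots> \<le> liminf (\<lambda>k. integral\<^sup>N M (f k))" by (rule nn_integral_liminf) simp
  also have "\<dots> \<le> ennreal (exp ((L \<theta> - L x) / \<sigma>\<^sup>2)) * (1 + ennreal (exp (2 * T * C)) * 2)"
  proof (intro Liminf_le always_eventually allI)
    fix k
    show "integral\<^sup>N M (f k) \<le> ennreal (exp ((L \<theta> - L x) / \<sigma>\<^sup>2)) * (1 + ennreal (exp (2 * T * C)) * 2)"
      unfolding f_def[abs_def]
      by (rule truncated_euler_bound[OF T N(1) _ less_imp_le[OF \<epsilon>(1)] \<epsilon>(2) C q N(3)]) simp_all
  qed simp
  also have "\<dots> < \<infinity>" by (simp add: ennreal_mult_less_top)
  finally show ?thesis .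
qed

end

section \<open>Tubes\<close>

text \<open>Piecewise linear interpolation of \<open>x, a, a, x\<close> at the grid points \<open>0, m, 2m, 3m\<close>.\<close>

definition tube_center :: "nat \<Rightarrow> real \<Rightarrow> real \<Rightarrow> nat \<Rightarrow> real" where
  "tube_center m x a i = x + (a - x) * min 1 (min (real i / real m) (3 - real i / real m))"

lemma tube_center_simps:
  assumes "m > 0"
  shows "tube_center m x a 0 = x" "tube_center m x a (3 * m) = x"
    and "m \<le> i \<Longrightarrow> i \<le> 2 * m \<Longrightarrow> tube_center m x a i = a"
    and "i < m \<Longrightarrow> tube_center m x a (Suc i) - tube_center m x a i = (a - x) / real m"
    and "m \<le> i \<Longrightarrow> i < 2 * m \<Longrightarrow> tube_center m x a (Suc i) - tube_center m x a i = 0"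
    and "2 * m \<le> i \<Longrightarrow> tube_center m x a (Suc i) - tube_center m x a i = - ((a - x) / real m)"
    and "i \<le> 3 * m \<Longrightarrow> \<bar>tube_center m x a i\<bar> \<le> \<bar>x\<bar> + \<bar>a\<bar>"
proof -
  have m: "real m > 0" using assms by simp
  have asc: "tube_center m x a i = x + (a - x) * (real i / real m)" if "i \<le> m" for i
  proof -
    have "real i / real m \<le> 1" using that m by simp
    then show ?thesis by (simp add: tube_center_def min_def)
  qed
  have mid: "tube_center m x a i = a" if "m \<le> i" "i \<le> 2 * m" for i
  proof -
    have "real i / real m \<ge> 1" "real i / real m \<le> 2" using that m by (auto simp: field_simps)
    then show ?thesis by (simp add: tube_center_def min_def)
  qed
  have desc: "tube_center m x a i = x + (a - x) * (3 - real i / real m)" if "2 * m \<le> i" for i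
  proof -
    have "real i / real m \<ge> 2" using that m by (auto simp: field_simps)
    then show ?thesis by (simp add: tube_center_def min_def)
  qed
  show "tube_center m x a 0 = x" "tube_center m x a (3 * m) = x"
    using asc[of 0] desc[of "3 * m"] m by simp_all
  show "tube_center m x a i = a" if "m \<le> i" "i \<le> 2 * m" using mid that by blast
  show "tube_center m x a (Suc i) - tube_center m x a i = (a - x) / real m" if "i < m"
    using asc[of i] asc[of "Suc i"] that m by (simp add: field_simps)
  show "tube_center m x a (Suc i) - tube_center m x a i = 0" if "m \<le> i" "i < 2 * m"
    using mid[of i] mid[of "Suc i"] that by simp
  show "tube_center m x a (Suc i) - tube_center m x a i = - ((a - x) / real m)" if "2 * m \<le> i"
    using desc[of i] desc[of "Suc i"] that m by (simp add: field_simps)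
  show "\<bar>tube_center m x a i\<bar> \<le> \<bar>x\<bar> + \<bar>a\<bar>" if "i \<le> 3 * m"
  proof -
    define t where "t = min 1 (min (real i / real m) (3 - real i / real m))"
    have t: "0 \<le> t" "t \<le> 1" using that m by (auto simp: t_def field_simps)
    have "tube_center m x a i = (1 - t) * x + t * a" by (simp add: tube_center_def t_def algebra_simps)
    also have "\<bar>\<dots>\<bar> \<le> (1 - t) * \<bar>x\<bar> + t * \<bar>a\<bar>"
      using abs_triangle_ineq[of "(1 - t) * x" "t * a"] t by (simp add: abs_mult)
    also have "\<dots> \<le> 1 * \<bar>x\<bar> + 1 * \<bar>a\<bar>" using t by (intro add_mono mult_right_mono) auto
    finally show ?thesis by simp
  qed
qed

lemma sum_thirds:
  fixes f :: "nat \<Rightarrow> 'b::comm_monoid_add"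
  shows "(\<Sum>i<3*m. f i) = (\<Sum>i<m. f i) + (\<Sum>i=m..<2*m. f i) + (\<Sum>i=2*m..<3*m. f i)"
  using sum.atLeastLessThan_concat[of 0 m "2*m" f] sum.atLeastLessThan_concat[of 0 "2*m" "3*m" f]
  by (simp add: atLeast0LessThan)

text \<open>Fourth powers reduce the claim to \<open>exp 1 < 4\<close>. The quotient is the factor
  per step in the Chernoff bound for the quadratic variation.\<close>

lemma exp_quarter_less: "exp (1/4) / sqrt 2 < (1::real)"
proof -
  have "exp (1/4) ^ 4 = exp (1::real)" by (simp add: exp_of_nat_mult[symmetric])
  also have "\<dots> < 4" using exp_le by simp
  also have "(4::real) = sqrt 2 ^ 4" by (simp add: power4_eq_xxxx)
  finally have "exp (1/4) < (sqrt 2 :: real)" by (rule power_less_imp_less_base) simp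
  then show ?thesis by simp
qed

section \<open>Small oscillation of the noise together with a quadratic variation that is not
  small\<close>

context sde
begin

text \<open>By \<open>sum_Z\<close> the bounded quantities are the partial sums of the noise steps,
  so on this event a walk carried along a tube centre stays within distance one of it.\<close>

definition small_oscillation :: "real \<Rightarrow> nat \<Rightarrow> 'a \<Rightarrow> bool" where
  "small_oscillation T n \<omega> \<longleftrightarrow> (\<forall>i\<le>n. \<bar>\<sigma> * (W (real i * (T / real n)) \<omega> - W 0 \<omega>)\<bar> \<le> 1)"

lemma pred_small_oscillation: "T \<ge> 0 \<Longrightarrow> Measurable.pred M (small_oscillation T n)"
proof -
  assume "T \<ge> 0"
  then have [measurable]: "W (real i * (T / real n)) \<in> borel_measurable M" "W 0 \<in> borel_measurable M" for i
    by (auto intro: measurable_W)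
  show ?thesis unfolding small_oscillation_def[abs_def] by measurable
qed

text \<open>Continuity of Brownian paths at time zero: the events of small oscillation up to time
  \<open>1 / real (Suc j)\<close> increase to an almost sure event. The horizon must not depend on
  the grid size \<open>n\<close>.\<close>

lemma small_oscillation_likely:
  assumes "T0 > 0"
  obtains T where "0 < T" "T \<le> T0" "\<And>n. n > 0 \<Longrightarrow> prob {\<omega> \<in> space M. small_oscillation T n \<omega>} \<ge> 3/4"
proof -
  \<comment> \<open>Rational times make this a countable intersection, hence measurable, and cover
    the grids of all sizes at once.\<close>
  define A where "A j = {\<omega> \<in> space M. \<forall>i n. real i / real n \<le> 1 / real (Suc j) \<longrightarrow>
    \<bar>\<sigma> * (W (real i / real n) \<omega> - W 0 \<omega>)\<bar> \<le> 1}" for j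
  have A: "A j \<in> events" for j
  proof -
    have [measurable]: "W (real i / real n) \<in> borel_measurable M" "W 0 \<in> borel_measurable M" for i n
      by (auto intro: measurable_W)
    show ?thesis unfolding A_def by measurable
  qed
  have inc: "incseq A"
  proof (rule monoI)
    fix j k :: nat assume "j \<le> k"
    then have "1 / real (Suc k) \<le> 1 / real (Suc j)" by (simp add: frac_le)
    then show "A j \<subseteq> A k" unfolding A_def by (fast intro: order_trans)
  qed
  have "AE \<omega> in M. \<omega> \<in> (\<Union>j. A j)"
  proof -
    have "AE \<omega> in M. continuous_on {0..} (\<lambda>t. W t \<omega>)"
      using W by (simp add: standard_brownian_motion_def)
    then show ?thesis
      using AE_space
    proof eventually_elim
      case (elim \<omega>)
      have c: "continuous_on {0..} (\<lambda>t. \<sigma> * (W t \<omega> - W 0 \<omega>))" using elim(1) by (intro continuous_intros)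
      obtain d where d: "d > 0" "\<And>t. t \<ge> 0 \<Longrightarrow> \<bar>t\<bar> < d \<Longrightarrow> \<bar>\<sigma> * (W t \<omega> - W 0 \<omega>)\<bar> < 1"
        using c[unfolded continuous_on_iff, rule_format, of 0 1] by (auto simp: dist_real_def)
      obtain j where j: "inverse (real (Suc j)) < d" using reals_Archimedean[OF d(1)] by blast
      have "\<omega> \<in> A j" unfolding A_def
        using elim(2) d(2) j by (auto simp: inverse_eq_divide intro!: less_imp_le)
      then show ?case by blast
    qed
  qed
  then have "prob (\<Union>j. A j) = 1" using A by (intro prob_eq_1[THEN iffD2]) auto
  moreover have "(\<lambda>j. prob (A j)) \<longlonglongrightarrow> prob (\<Union>j. A j)"
    using A inc by (intro finite_Lim_measure_incseq) auto
  ultimately have "\<forall>\<^sub>F j in sequentially. prob (A j) > 3/4"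
    by (intro order_tendstoD(1)[where y=1]) auto
  moreover have "\<forall>\<^sub>F j in sequentially. 1 / real (Suc j) < T0"
    using order_tendstoD(2)[OF LIMSEQ_inverse_real_of_nat assms] by (simp add: inverse_eq_divide)
  ultimately have "\<forall>\<^sub>F j in sequentially. prob (A j) > 3/4 \<and> 1 / real (Suc j) < T0" by eventually_elim simp
  then obtain j where j: "prob (A j) > 3/4" "1 / real (Suc j) < T0"
    by (auto simp: eventually_sequentially)
  show ?thesis
  proof (rule that[of "1 / real (Suc j)"])
    fix n :: nat assume n: "n > 0"
    have "A j \<subseteq> {\<omega> \<in> space M. small_oscillation (1 / real (Suc j)) n \<omega>}"
    proof
      fix \<omega> assume \<omega>: "\<omega> \<in> A j"
      show "\<omega> \<in> {\<omega> \<in> space M. small_oscillation (1 / real (Suc j)) n \<omega>}"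
        unfolding small_oscillation_def
      proof (intro CollectI conjI allI impI)
        show "\<omega> \<in> space M" using \<omega> by (simp add: A_def)
        fix i assume i: "i \<le> n"
        \<comment> \<open>With a horizon of this form every grid time is again a rational time
          listed in \<open>A j\<close>.\<close>
        have eq: "real i * (1 / real (Suc j) / real n) = real i / real (Suc j * n)" by (simp add: algebra_simps)
        have "real i / real (Suc j * n) \<le> real n / real (Suc j * n)" using i by (intro divide_right_mono) auto
        also have "\<dots> = 1 / real (Suc j)" using n by (simp del: of_nat_Suc mult_Suc)
        finally have "real i / real (Suc j * n) \<le> 1 / real (Suc j)" .
        then show "\<bar>\<sigma> * (W (real i * (1 / real (Suc j) / real n)) \<omega> - W 0 \<omega>)\<bar> \<le> 1"
          using \<omega> unfolding A_def eq by blast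
      qed
    qed
    then have "prob (A j) \<le> prob {\<omega> \<in> space M. small_oscillation (1 / real (Suc j)) n \<omega>}"
      using pred_small_oscillation[of "1 / real (Suc j)" n] by (intro finite_measure_mono) auto
    then show "prob {\<omega> \<in> space M. small_oscillation (1 / real (Suc j)) n \<omega>} \<ge> 3/4" using j by simp
  qed (use j in auto)
qed

text \<open>Chernoff bound for the quadratic variation over the middle third, whose mean is \<open>\<sigma>\<^sup>2 T / 3\<close>.\<close>

lemma small_quadratic_variation_prob:
  assumes T: "T > 0" and m: "m > 0"
  shows "prob {\<omega> \<in> space M. (\<Sum>i=m..<2*m. (Z T (3*m) i \<omega>)\<^sup>2) < \<sigma>\<^sup>2 * T / 6} \<le> (exp (1/4) / sqrt 2) ^ m"
proof -
  define n where "n = 3 * m"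
  define s where "s = \<sigma> * sqrt (T / real n)"
  have s2: "s\<^sup>2 = \<sigma>\<^sup>2 * (T / real n)" using T by (simp add: s_def power_mult_distrib)
  have n: "n > 0" using m by (simp add: n_def)
  interpret S: gaussian_steps M "Z T n" n s
    using gaussian_steps_Z[OF T n] by (simp add: s_def)
  have sp: "s > 0" by (rule S.s_pos)
  \<comment> \<open>Under the step law the exponential has mean \<open>1 / sqrt 2\<close>, so the
    factor \<open>sqrt 2\<close> normalises each weight to mean one.\<close>
  define w where "w i y y' = (if m \<le> i \<and> i < 2*m then ennreal (sqrt 2) * ennreal (exp (- (1 / (2 * s\<^sup>2)) * (y' - y)\<^sup>2)) else 1)"
    for i and y y' :: real
  have [measurable]: "case_prod (w i) \<in> borel_measurable (borel \<Otimes>\<^sub>M borel)" for i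
    unfolding w_def by (cases "m \<le> i \<and> i < 2*m") auto
  interpret G: prob_space "gauss s" using sp by (rule prob_space_normal_density)
  have "(\<integral>\<^sup>+u. w i y (y + u) \<partial>gauss s) \<le> 1" for i y
  proof (cases "m \<le> i \<and> i < 2*m")
    case True
    have "(\<integral>\<^sup>+u. w i y (y + u) \<partial>gauss s) = (\<integral>\<^sup>+u. ennreal (sqrt 2) * ennreal (exp (- (1 / (2 * s\<^sup>2)) * u\<^sup>2)) \<partial>gauss s)"
      using True by (simp add: w_def)
    also have "\<dots> = ennreal (sqrt 2) * (\<integral>\<^sup>+u. ennreal (exp (- (1 / (2 * s\<^sup>2)) * u\<^sup>2)) \<partial>gauss s)"
      by (rule nn_integral_cmult) simp
    also have "\<dots> = ennreal (sqrt 2) * ennreal (1 / sqrt (1 - 2 * (- (1 / (2 * s\<^sup>2))) * s\<^sup>2))"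
      by (subst nn_integral_gauss_exp_square[OF sp]) (use sp in auto)
    also have "\<dots> = ennreal (sqrt 2 * (1 / sqrt (1 - 2 * (- (1 / (2 * s\<^sup>2))) * s\<^sup>2)))"
      using sp by (intro ennreal_mult[symmetric]) auto
    also have "1 - 2 * (- (1 / (2 * s\<^sup>2))) * s\<^sup>2 = 2" using sp by simp
    finally show ?thesis by simp
  next
    case False
    then have "w i = (\<lambda>_ _. 1)" by (auto simp: w_def fun_eq_iff)
    then have "(\<integral>\<^sup>+u. w i y (y + u) \<partial>gauss s) = (\<integral>\<^sup>+u. 1 \<partial>gauss s)" by (simp only:)
    also have "\<dots> = 1" unfolding nn_integral_const G.emeasure_space_1 by simp
    finally show ?thesis by simp
  qed
  then have le1: "(\<integral>\<^sup>+\<omega>. (\<Prod>i<n. w i (B T n \<omega> i) (B T n \<omega> (Suc i))) \<partial>M) \<le> 1"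
    unfolding B_def by (intro S.nn_integral_walk_prod_le_1) auto
  have prod: "(\<Prod>i<n. w i (B T n \<omega> i) (B T n \<omega> (Suc i)))
     = ennreal (sqrt 2 ^ m * exp (- (1 / (2 * s\<^sup>2)) * (\<Sum>i=m..<2*m. (Z T n i \<omega>)\<^sup>2)))" for \<omega>
  proof -
    have "(\<Prod>i<n. w i (B T n \<omega> i) (B T n \<omega> (Suc i))) = (\<Prod>i\<in>{m..<2*m}. w i (B T n \<omega> i) (B T n \<omega> (Suc i)))"
      by (rule prod.mono_neutral_right) (auto simp: n_def w_def)
    also have "\<dots> = (\<Prod>i\<in>{m..<2*m}. ennreal (sqrt 2 * exp (- (1 / (2 * s\<^sup>2)) * (Z T n i \<omega>)\<^sup>2)))"
      by (intro prod.cong) (auto simp: w_def B_Suc ennreal_mult)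
    also have "\<dots> = ennreal (\<Prod>i\<in>{m..<2*m}. sqrt 2 * exp (- (1 / (2 * s\<^sup>2)) * (Z T n i \<omega>)\<^sup>2))"
      by (rule prod_ennreal) simp
    also have "(\<Prod>i\<in>{m..<2*m}. sqrt 2 * exp (- (1 / (2 * s\<^sup>2)) * (Z T n i \<omega>)\<^sup>2))
      = sqrt 2 ^ m * exp (\<Sum>i=m..<2*m. - (1 / (2 * s\<^sup>2)) * (Z T n i \<omega>)\<^sup>2)"
      by (simp only: prod.distrib exp_sum[OF finite_atLeastLessThan]) simp
    finally show ?thesis by (simp only: sum_distrib_left)
  qed
  define E where "E = {\<omega> \<in> space M. (\<Sum>i=m..<2*m. (Z T n i \<omega>)\<^sup>2) < \<sigma>\<^sup>2 * T / 6}"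
  have [measurable]: "Z T n i \<in> borel_measurable M" for i using measurable_Z T by simp
  have E[measurable]: "E \<in> events" unfolding E_def by measurable
  have "ennreal (sqrt 2 ^ m * exp (- (real m / 4))) * emeasure M E
      = (\<integral>\<^sup>+\<omega>. ennreal (sqrt 2 ^ m * exp (- (real m / 4))) * indicator E \<omega> \<partial>M)"
    using E by (simp add: nn_integral_cmult_indicator)
  also have "\<dots> \<le> (\<integral>\<^sup>+\<omega>. (\<Prod>i<n. w i (B T n \<omega> i) (B T n \<omega> (Suc i))) \<partial>M)"
  proof (intro nn_integral_mono)
    fix \<omega>
    \<comment> \<open>The threshold is half of the mean \<open>real m * s\<^sup>2\<close>.\<close>
    have "1 / (2 * s\<^sup>2) * (\<sigma>\<^sup>2 * T / 6) = real m / 4"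
      unfolding s2 n_def using T \<sigma> m by (simp add: field_simps)
    moreover have "1 / (2 * s\<^sup>2) * (\<Sum>i=m..<2*m. (Z T n i \<omega>)\<^sup>2) \<le> 1 / (2 * s\<^sup>2) * (\<sigma>\<^sup>2 * T / 6)" if "\<omega> \<in> E"
      using that sp by (intro mult_left_mono) (auto simp: E_def)
    ultimately have "- (real m / 4) \<le> - (1 / (2 * s\<^sup>2)) * (\<Sum>i=m..<2*m. (Z T n i \<omega>)\<^sup>2)" if "\<omega> \<in> E"
      using that by (simp only: mult_minus_left neg_le_iff_le)
    then show "ennreal (sqrt 2 ^ m * exp (- (real m / 4))) * indicator E \<omega>
        \<le> (\<Prod>i<n. w i (B T n \<omega> i) (B T n \<omega> (Suc i)))"
      unfolding prod by (cases "\<omega> \<in> E") (auto intro!: ennreal_leI simp del: times_divide_eq_left)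
  qed
  also note le1
  finally have "sqrt 2 ^ m * exp (- (real m / 4)) * prob E \<le> 1"
    by (simp add: emeasure_eq_measure ennreal_mult[symmetric])
  then have "prob E \<le> exp (real m / 4) / sqrt 2 ^ m"
    by (simp add: exp_minus field_simps)
  also have "\<dots> = (exp (1/4) / sqrt 2) ^ m"
    by (simp add: power_divide exp_of_nat_mult[symmetric])
  finally show ?thesis by (simp add: E_def n_def)
qed

end

section \<open>Supercritical drifts\<close>

context sde
begin

text \<open>The exponent has four parts. The potential telescopes and \<open>U\<close> ends within
  distance one of \<open>x\<close>; the quadratic variation of the middle third yields the gain
  \<open>\<kappa> * T / 12\<close>; the linear and quadratic parts of the inverse shift density
  yield the costs \<open>9 * \<bar>a - x\<bar>\<close> and \<open>3 * (a - x)\<^sup>2\<close>, both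
  over \<open>\<sigma>\<^sup>2 * T\<close>.\<close>

lemma tube_girsanov_exponent:
  fixes a :: real and m :: nat and \<omega> :: 'a
  assumes T: "T > 0" and m: "m > 0" and small: "small_oscillation T (3*m) \<omega>"
    and var: "\<sigma>\<^sup>2 * T / 6 \<le> (\<Sum>i=m..<2*m. (Z T (3*m) i \<omega>)\<^sup>2)"
    and \<kappa>: "\<kappa> \<ge> 0" and l: "\<And>y. \<bar>y - x\<bar> \<le> 1 \<Longrightarrow> l \<le> L y"
  defines "d \<equiv> \<lambda>i. tube_center m x a (Suc i) - tube_center m x a i"
    and "U \<equiv> \<lambda>i. tube_center m x a i + (\<Sum>j<i. Z T (3*m) j \<omega>)"
    and "s \<equiv> \<sigma> * sqrt (T / real (3*m))"
  shows "(l - L x) / \<sigma>\<^sup>2 - (9 * \<bar>a - x\<bar> + 3 * (a - x)\<^sup>2) / (\<sigma>\<^sup>2 * T) + \<kappa> * T / 12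
    \<le> (\<Sum>i<3*m. (L (U (Suc i)) - L (U i)) / \<sigma>\<^sup>2
          + (if m \<le> i \<and> i < 2*m then \<kappa> / (2 * \<sigma>\<^sup>2) else 0) * (U (Suc i) - U i)\<^sup>2
          - (d i * (U (Suc i) - U i) - (d i)\<^sup>2 / 2) / s\<^sup>2)"
proof -
  let ?z = "\<lambda>i. Z T (3*m) i \<omega>"
  define S where "S i = (\<Sum>j<i. ?z j)" for i
  define \<delta> where "\<delta> = (a - x) / real m"
  have rm: "real m > 0" using m by simp
  have s2: "s\<^sup>2 = \<sigma>\<^sup>2 * T / (3 * real m)" using T by (simp add: s_def power_mult_distrib)
  have s0: "s\<^sup>2 > 0" using T \<sigma> m by (simp add: s2)
  have S1: "\<bar>S i\<bar> \<le> 1" if "i \<le> 3*m" for i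
    using small that by (simp only: S_def sum_Z small_oscillation_def)
  have dz: "d i = \<delta>" if "i < m" for i using tube_center_simps(4)[OF m that] by (simp add: d_def \<delta>_def)
  have dm: "d i = 0" if "m \<le> i" "i < 2*m" for i using tube_center_simps(5)[OF m that] by (simp add: d_def)
  have de: "d i = - \<delta>" if "2*m \<le> i" for i using tube_center_simps(6)[OF m that] by (simp add: d_def \<delta>_def)
  have step: "U (Suc i) - U i = d i + ?z i" for i by (simp add: U_def d_def)
  \<comment> \<open>The walk moves by \<open>d i\<close> plus noise, so subtracting the logarithmic
    shift density leaves minus a term linear in the noise and minus half of the squared
    displacement, both over \<open>s\<^sup>2\<close>. In the middle third \<open>d i\<close>
    vanishes and the step is pure noise.\<close>
  have term_eq: "(if m \<le> i \<and> i < 2*m then \<kappa> / (2 * \<sigma>\<^sup>2) else 0) * (U (Suc i) - U i)\<^sup>2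
          - (d i * (U (Suc i) - U i) - (d i)\<^sup>2 / 2) / s\<^sup>2
       = (if m \<le> i \<and> i < 2*m then \<kappa> / (2 * \<sigma>\<^sup>2) * (?z i)\<^sup>2 else 0) - (d i * ?z i) / s\<^sup>2 - (d i)\<^sup>2 / (2 * s\<^sup>2)" for i
  proof -
    have "(D * (D + z) - D\<^sup>2 / 2) / s\<^sup>2 = D * z / s\<^sup>2 + D\<^sup>2 / (2 * s\<^sup>2)" for D z
      using s0 by (simp add: add_divide_distrib[symmetric] power2_eq_square divide_simps) (simp add: algebra_simps)
    then show ?thesis unfolding step by (auto simp: dm)
  qed
  have sum1: "(\<Sum>i<3*m. (L (U (Suc i)) - L (U i)) / \<sigma>\<^sup>2) = (L (U (3*m)) - L x) / \<sigma>\<^sup>2"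
  proof -
    have "U 0 = x" using tube_center_simps(1)[OF m] by (simp add: U_def)
    then show ?thesis
      unfolding sum_divide_distrib[symmetric] by (simp only: sum_lessThan_telescope[of "\<lambda>i. L (U i)"])
  qed
  have sum2: "(\<Sum>i<3*m. if m \<le> i \<and> i < 2*m then \<kappa> / (2 * \<sigma>\<^sup>2) * (?z i)\<^sup>2 else 0)
      = \<kappa> / (2 * \<sigma>\<^sup>2) * (\<Sum>i=m..<2*m. (?z i)\<^sup>2)"
    unfolding sum_thirds by (simp add: sum_distrib_left)
  \<comment> \<open>The displacement is constant on each third, so the linear part sees the noise
    only through partial sums at \<open>m\<close>, \<open>2*m\<close> and \<open>3*m\<close>, each
    at most one in absolute value.\<close>
  have sum3: "(\<Sum>i<3*m. d i * ?z i) = \<delta> * S m - \<delta> * (S (3*m) - S (2*m))"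
  proof -
    have "(\<Sum>i=2*m..<3*m. ?z i) = S (3*m) - S (2*m)"
      using sum.atLeastLessThan_concat[of 0 "2*m" "3*m" ?z] by (simp add: S_def atLeast0LessThan)
    moreover have "(\<Sum>i=2*m..<3*m. d i * ?z i) = - \<delta> * (\<Sum>i=2*m..<3*m. ?z i)"
      unfolding sum_distrib_left by (intro sum.cong) (auto simp: de)
    ultimately show ?thesis
      unfolding sum_thirds by (simp add: dz dm S_def sum_distrib_left)
  qed
  have sum4: "(\<Sum>i<3*m. (d i)\<^sup>2) = 2 * real m * \<delta>\<^sup>2"
    unfolding sum_thirds by (simp add: dz dm de)
  have "(\<Sum>i<3*m. d i * ?z i) \<le> 3 * \<bar>\<delta>\<bar>"
  proof -
    have "\<bar>S m - (S (3*m) - S (2*m))\<bar> \<le> 3" using S1[of m] S1[of "2*m"] S1[of "3*m"] by simp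
    then have "\<bar>\<delta> * (S m - (S (3*m) - S (2*m)))\<bar> \<le> \<bar>\<delta>\<bar> * 3" unfolding abs_mult by (intro mult_left_mono) auto
    then show ?thesis unfolding sum3 by (simp add: algebra_simps)
  qed
  then have "(\<Sum>i<3*m. d i * ?z i) / s\<^sup>2 \<le> 3 * \<bar>\<delta>\<bar> / s\<^sup>2" using s0 by (intro divide_right_mono) auto
  also have "\<dots> = 9 * \<bar>a - x\<bar> / (\<sigma>\<^sup>2 * T)" using rm T \<sigma> by (simp add: s2 \<delta>_def field_simps)
  finally have b3: "(\<Sum>i<3*m. d i * ?z i) / s\<^sup>2 \<le> 9 * \<bar>a - x\<bar> / (\<sigma>\<^sup>2 * T)" .
  have b4: "(\<Sum>i<3*m. (d i)\<^sup>2) / (2 * s\<^sup>2) = 3 * (a - x)\<^sup>2 / (\<sigma>\<^sup>2 * T)"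
  proof -
    have "2 * real m * (v / (real m)\<^sup>2) / (2 * (\<sigma>\<^sup>2 * T / (3 * real m))) = 3 * v / (\<sigma>\<^sup>2 * T)" for v
      using rm T \<sigma> by (simp add: field_simps power2_eq_square)
    then show ?thesis unfolding sum4 \<delta>_def power_divide s2 .
  qed
  have "U (3*m) = x + S (3*m)" using tube_center_simps(2)[OF m] by (simp add: U_def S_def)
  then have "l \<le> L (U (3*m))" using S1[of "3*m"] by (intro l) simp
  then have b1: "(l - L x) / \<sigma>\<^sup>2 \<le> (L (U (3*m)) - L x) / \<sigma>\<^sup>2" by (intro divide_right_mono) auto
  have "\<kappa> / (2 * \<sigma>\<^sup>2) * (\<sigma>\<^sup>2 * T / 6) \<le> \<kappa> / (2 * \<sigma>\<^sup>2) * (\<Sum>i=m..<2*m. (?z i)\<^sup>2)"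
    using var \<kappa> by (intro mult_left_mono) auto
  then have b2: "\<kappa> * T / 12 \<le> \<kappa> / (2 * \<sigma>\<^sup>2) * (\<Sum>i=m..<2*m. (?z i)\<^sup>2)" using \<sigma> by simp
  have "(\<Sum>i<3*m. (L (U (Suc i)) - L (U i)) / \<sigma>\<^sup>2
          + (if m \<le> i \<and> i < 2*m then \<kappa> / (2 * \<sigma>\<^sup>2) else 0) * (U (Suc i) - U i)\<^sup>2
          - (d i * (U (Suc i) - U i) - (d i)\<^sup>2 / 2) / s\<^sup>2)
     = (L (U (3*m)) - L x) / \<sigma>\<^sup>2 + \<kappa> / (2 * \<sigma>\<^sup>2) * (\<Sum>i=m..<2*m. (?z i)\<^sup>2)
       - (\<Sum>i<3*m. d i * ?z i) / s\<^sup>2 - (\<Sum>i<3*m. (d i)\<^sup>2) / (2 * s\<^sup>2)"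
    unfolding add_diff_eq[symmetric] term_eq sum.distrib sum_subtractf sum1 sum2 sum_divide_distrib
    by simp
  then show ?thesis using b1 b2 b3 b4 by (simp add: add_divide_distrib)
qed

text \<open>Two changes of drift are combined. A walk carried along the tube centre stays in the
  tube with probability at least one half; removing its displacement leads to \<open>B\<close>,
  where the expansion bounds the exponent by the stochastic sum, and \<open>euler_girsanov\<close>
  leads from there to the Euler scheme.\<close>

lemma euler_tube_bound:
  fixes a :: real and m :: nat
  assumes T: "T > 0" and m: "m > 0" and \<kappa>: "\<kappa> \<ge> 0" and l: "\<And>y. \<bar>y - x\<bar> \<le> 1 \<Longrightarrow> l \<le> L y"
    and q: "\<And>v. \<bar>v - a\<bar> \<le> 1 \<Longrightarrow> \<kappa> \<le> neg_slope b v"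
    and small: "prob {\<omega> \<in> space M. small_oscillation T (3*m) \<omega>} \<ge> 3/4"
    and chernoff: "(exp (1/4) / sqrt 2) ^ m \<le> (1/4 :: real)"
  defines "n \<equiv> 3*m" and "c \<equiv> tube_center m x a"
  shows "ennreal (1/2 * exp ((l - L x) / \<sigma>\<^sup>2 - (9 * \<bar>a - x\<bar> + 3 * (a - x)\<^sup>2) / (\<sigma>\<^sup>2 * T) + \<kappa> * T / 12))
    \<le> (\<integral>\<^sup>+\<omega>. (if \<forall>i<n. \<bar>Y T n \<omega> i - c i\<bar> \<le> 1 \<and> \<bar>Y T n \<omega> (Suc i) - c (Suc i)\<bar> \<le> 1
            then ennreal (exp (1/2 * energy T n \<omega>)) else 0) \<partial>M)" (is "ennreal (1/2 * ?e) \<le> _")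
proof -
  have n: "n > 0" using m by (simp add: n_def)
  define s where "s = \<sigma> * sqrt (T / real n)"
  interpret S: gaussian_steps M "Z T n" n s
    using gaussian_steps_Z[OF T n] by (simp add: s_def)
  define d where "d i = c (Suc i) - c i" for i
  define k where "k i = (if m \<le> i \<and> i < 2*m then \<kappa> / (2 * \<sigma>\<^sup>2) else 0)" for i
  \<comment> \<open>Inside the tube \<open>A0\<close> is a lower bound for the summand of the
    stochastic sum. Subtracting the logarithmic shift density in \<open>A\<close> anticipates the
    change of drift, which adds it back.\<close>
  define A0 where "A0 i y y' = (L y' - L y) / \<sigma>\<^sup>2 + k i * (y' - y)\<^sup>2" for i y y'
  define A where "A i y y' = A0 i y y' - (d i * (y' - y) - (d i)\<^sup>2 / 2) / s\<^sup>2" for i y y'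
  define G where "G i y y' \<longleftrightarrow> \<bar>y - c i\<bar> \<le> 1 \<and> \<bar>y' - c (Suc i)\<bar> \<le> 1" for i y y'
  have Lm[measurable]: "L \<in> borel_measurable borel"
    using DERIV_isCont[OF L] by (intro borel_measurable_continuous_onI) (simp add: continuous_at_imp_continuous_on)
  have G[measurable]: "Measurable.pred (borel \<Otimes>\<^sub>M borel) (case_prod (G i))" for i
    unfolding G_def by measurable
  have A[measurable]: "case_prod (A i) \<in> borel_measurable (borel \<Otimes>\<^sub>M borel)" for i
    unfolding A_def A0_def by measurable
  define U where "U \<omega> i = c i + (\<Sum>j<i. Z T n j \<omega>)" for \<omega> i
  have U: "walk (\<lambda>i _. d i) x (\<lambda>j. Z T n j \<omega>) = U \<omega>" for \<omega>
    using walk_deterministic[of c "\<lambda>j. Z T n j \<omega>"] tube_center_simps(1)[OF m, of x a]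
    by (simp add: d_def U_def fun_eq_iff c_def)
  define E where "E = {\<omega> \<in> space M. small_oscillation T n \<omega>}"
  define F where "F = {\<omega> \<in> space M. (\<Sum>i=m..<2*m. (Z T n i \<omega>)\<^sup>2) < \<sigma>\<^sup>2 * T / 6}"
  have E: "E \<in> events" unfolding E_def using pred_small_oscillation[of T n] T by simp
  have F: "F \<in> events"
  proof -
    have [measurable]: "Z T n i \<in> borel_measurable M" for i using measurable_Z T by simp
    show ?thesis unfolding F_def by measurable
  qed
  have "prob F \<le> 1/4" using small_quadratic_variation_prob[OF T m] chernoff by (simp add: F_def n_def)
  moreover have "prob E \<ge> 3/4" using small by (simp add: E_def n_def)
  moreover have "prob E \<le> prob (E - F) + prob F"
    using finite_measure_mono[of E "E - F \<union> F"] measure_Un_le[of "E - F" M F] E F by auto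
  ultimately have EF: "prob (E - F) \<ge> 1/2" by linarith
  have "ennreal (1/2 * ?e) \<le> ennreal ?e * emeasure M (E - F)"
    using EF by (simp add: emeasure_eq_measure ennreal_mult[symmetric] mult.commute)
  also have "\<dots> = (\<integral>\<^sup>+\<omega>. ennreal ?e * indicator (E - F) \<omega> \<partial>M)"
    using E F by (simp add: nn_integral_cmult_indicator)
  also have "\<dots> \<le> (\<integral>\<^sup>+\<omega>. (if \<forall>i<n. G i (U \<omega> i) (U \<omega> (Suc i))
            then ennreal (exp (\<Sum>i<n. A i (U \<omega> i) (U \<omega> (Suc i)))) else 0) \<partial>M)"
  proof (intro nn_integral_mono)
    fix \<omega>
    show "ennreal ?e * indicator (E - F) \<omega> \<le> (if \<forall>i<n. G i (U \<omega> i) (U \<omega> (Suc i))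
            then ennreal (exp (\<Sum>i<n. A i (U \<omega> i) (U \<omega> (Suc i)))) else 0)"
    proof (cases "\<omega> \<in> E - F")
      case True
      then have sm: "small_oscillation T (3*m) \<omega>" and v: "\<sigma>\<^sup>2 * T / 6 \<le> (\<Sum>i=m..<2*m. (Z T (3*m) i \<omega>)\<^sup>2)"
        by (auto simp: E_def F_def n_def)
      have "?e \<le> exp (\<Sum>i<n. A i (U \<omega> i) (U \<omega> (Suc i)))"
        using tube_girsanov_exponent[OF T m sm v \<kappa> l, of a]
        by (simp only: A_def A0_def k_def d_def U_def c_def n_def s_def exp_le_cancel_iff)
      moreover have "\<bar>\<Sum>j<i. Z T n j \<omega>\<bar> \<le> 1" if "i \<le> n" for i
        using sm that unfolding sum_Z small_oscillation_def by (simp add: n_def)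
      then have "\<forall>i<n. G i (U \<omega> i) (U \<omega> (Suc i))"
        by (auto simp: G_def U_def simp del: sum.lessThan_Suc)
      ultimately show ?thesis using True by (simp add: ennreal_leI)
    qed simp
  qed
  also have "\<dots> = (\<integral>\<^sup>+\<omega>. (if \<forall>i<n. G i (B T n \<omega> i) (B T n \<omega> (Suc i))
            then ennreal (exp (\<Sum>i<n. A0 i (B T n \<omega> i) (B T n \<omega> (Suc i)))) else 0) \<partial>M)"
  proof -
    have Beq: "walk (\<lambda>_ _. 0) x (\<lambda>j. Z T n j \<omega>) = B T n \<omega>" for \<omega> by (simp add: B_def)
    have cancel: "A i y y' + (d i * (y' - y) - (d i)\<^sup>2 / 2) / s\<^sup>2 = A0 i y y'" for i y y'
      by (simp add: A_def)
    show ?thesis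
      using S.discrete_girsanov[of "\<lambda>i _. d i" G A x, OF _ G A] unfolding U Beq cancel by simp
  qed
  also have "\<dots> \<le> (\<integral>\<^sup>+\<omega>. (if \<forall>i<n. G i (B T n \<omega> i) (B T n \<omega> (Suc i))
            then ennreal (exp (\<Sum>i<n. b (B T n \<omega> i) * Z T n i \<omega> / \<sigma>\<^sup>2)) else 0) \<partial>M)"
  proof (intro nn_integral_mono)
    fix \<omega>
    show "(if \<forall>i<n. G i (B T n \<omega> i) (B T n \<omega> (Suc i))
            then ennreal (exp (\<Sum>i<n. A0 i (B T n \<omega> i) (B T n \<omega> (Suc i)))) else 0)
       \<le> (if \<forall>i<n. G i (B T n \<omega> i) (B T n \<omega> (Suc i))
            then ennreal (exp (\<Sum>i<n. b (B T n \<omega> i) * Z T n i \<omega> / \<sigma>\<^sup>2)) else 0)"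
    proof (cases "\<forall>i<n. G i (B T n \<omega> i) (B T n \<omega> (Suc i))")
      case True
      have step: "A0 i (B T n \<omega> i) (B T n \<omega> (Suc i)) \<le> b (B T n \<omega> i) * Z T n i \<omega> / \<sigma>\<^sup>2" if i: "i < n" for i
      proof -
        let ?y = "B T n \<omega> i" and ?y' = "B T n \<omega> (Suc i)"
        obtain v where v: "v \<in> closed_segment ?y ?y'"
          "b ?y * (?y' - ?y) = L ?y' - L ?y + neg_slope b v / 2 * (?y' - ?y)\<^sup>2"
          using drift_taylor[OF b L] by blast
        \<comment> \<open>In the middle third both ends of the step have centre \<open>a\<close>,
          including the step that ends at \<open>2*m\<close>, so the whole segment lies within
          distance one of \<open>a\<close>. In the outer thirds nonnegativity of the slope
          suffices.\<close>
        have "k i \<le> neg_slope b v / (2 * \<sigma>\<^sup>2)"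
        proof (cases "m \<le> i \<and> i < 2*m")
          case mid: True
          then have "\<bar>?y - a\<bar> \<le> 1" "\<bar>?y' - a\<bar> \<le> 1"
            using True i tube_center_simps(3)[OF m, of i x a] tube_center_simps(3)[OF m, of "Suc i" x a]
            by (auto simp: G_def c_def)
          then have "\<bar>v - a\<bar> \<le> 1"
            using v(1) by (auto simp: closed_segment_eq_real_ivl split: if_splits)
          then have "\<kappa> \<le> neg_slope b v" by (rule q)
          then show ?thesis using mid by (simp add: k_def divide_right_mono)
        next
          case False
          then show ?thesis using neg_slope_nonneg[OF b, of v] by (simp only: k_def if_False) simp
        qed
        then have "k i * (?y' - ?y)\<^sup>2 \<le> neg_slope b v / (2 * \<sigma>\<^sup>2) * (?y' - ?y)\<^sup>2" by (intro mult_right_mono) auto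
        moreover have "b ?y * (?y' - ?y) / \<sigma>\<^sup>2 = (L ?y' - L ?y) / \<sigma>\<^sup>2 + neg_slope b v / (2 * \<sigma>\<^sup>2) * (?y' - ?y)\<^sup>2"
          unfolding v(2) by (simp add: add_divide_distrib)
        ultimately show ?thesis unfolding A0_def B_Suc by linarith
      qed
      have "(\<Sum>i<n. A0 i (B T n \<omega> i) (B T n \<omega> (Suc i))) \<le> (\<Sum>i<n. b (B T n \<omega> i) * Z T n i \<omega> / \<sigma>\<^sup>2)"
        by (intro sum_mono step) simp
      then show ?thesis using True by (simp add: ennreal_leI)
    next
      case False
      then show ?thesis by (simp only: if_False) 
    qed
  qed
  also have "\<dots> = (\<integral>\<^sup>+\<omega>. (if \<forall>i<n. G i (Y T n \<omega> i) (Y T n \<omega> (Suc i))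
            then ennreal (exp (1/2 * energy T n \<omega>)) else 0) \<partial>M)"
    by (rule euler_girsanov[OF T n G, symmetric])
  finally show ?thesis by (simp only: G_def)
qed

text \<open>Confinement to the tube bounds the scheme, hence also its energy, uniformly in
  \<open>m\<close>. This constant dominates the truncated functionals, so the reverse Fatou lemma
  carries the lower bound to the limit.\<close>

lemma novikov_half_ge:
  assumes T: "T > 0" and small: "\<And>n. n > 0 \<Longrightarrow> prob {\<omega> \<in> space M. small_oscillation T n \<omega>} \<ge> 3/4"
    and \<kappa>: "\<kappa> \<ge> 0" and l: "\<And>y. \<bar>y - x\<bar> \<le> 1 \<Longrightarrow> l \<le> L y"
    and q: "\<And>v. \<bar>v - a\<bar> \<le> 1 \<Longrightarrow> \<kappa> \<le> neg_slope b v"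
  shows "ennreal (1/2 * exp ((l - L x) / \<sigma>\<^sup>2 - (9 * \<bar>a - x\<bar> + 3 * (a - x)\<^sup>2) / (\<sigma>\<^sup>2 * T) + \<kappa> * T / 12))
    \<le> novikov_half M b \<sigma> X T" (is "?e \<le> _")
proof -
  define f where "f m \<omega> = (if \<forall>i<3*m. \<bar>Y T (3*m) \<omega> i - tube_center m x a i\<bar> \<le> 1
        \<and> \<bar>Y T (3*m) \<omega> (Suc i) - tube_center m x a (Suc i)\<bar> \<le> 1
      then ennreal (exp (1/2 * energy T (3*m) \<omega>)) else 0)" for m \<omega>
  have f[measurable]: "f m \<in> borel_measurable M" for m
  proof -
    have [measurable]: "(\<lambda>\<omega>. Y T (3*m) \<omega> i) \<in> borel_measurable M" "(\<lambda>\<omega>. energy T (3*m) \<omega>) \<in> borel_measurable M" for i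
      using measurable_Y measurable_energy T by auto
    show ?thesis unfolding f_def[abs_def] by measurable
  qed
  have "(\<lambda>m. (exp (1/4) / sqrt 2) ^ m) \<longlonglongrightarrow> (0::real)"
    using exp_quarter_less by (intro LIMSEQ_power_zero) simp
  then have "\<forall>\<^sub>F m in sequentially. (exp (1/4) / sqrt 2) ^ m < (1/4::real)" by (rule order_tendstoD) simp
  then have "\<forall>\<^sub>F m in sequentially. ?e \<le> integral\<^sup>N M (f m)"
    using eventually_gt_at_top[of 0]
  proof eventually_elim
    case (elim m)
    show ?case unfolding f_def[abs_def]
      by (rule euler_tube_bound[OF T _ \<kappa> l q small]) (use elim in auto)
  qed
  then have "?e \<le> limsup (\<lambda>m. integral\<^sup>N M (f m))" by (intro le_Limsup) auto
  also have "\<dots> \<le> (\<integral>\<^sup>+\<omega>. limsup (\<lambda>m. f m \<omega>) \<partial>M)"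
  proof -
    define K where "K = \<bar>x\<bar> + \<bar>a\<bar> + 1"
    have "continuous_on {-K..K} (\<lambda>y. (b y)\<^sup>2 / \<sigma>\<^sup>2)"
      using \<sigma> by (intro continuous_intros continuous_on_drift[OF b]) auto
    from compact_imp_bounded[OF compact_continuous_image[OF this compact_Icc]]
    obtain C where C: "C > 0" "\<And>y. y \<in> {-K..K} \<Longrightarrow> \<bar>(b y)\<^sup>2 / \<sigma>\<^sup>2\<bar> \<le> C"
      unfolding bounded_pos by auto
    have bd: "f m \<omega> \<le> ennreal (exp (1/2 * (T * C)))" for m \<omega>
    proof (cases "\<forall>i<3*m. \<bar>Y T (3*m) \<omega> i - tube_center m x a i\<bar> \<le> 1
        \<and> \<bar>Y T (3*m) \<omega> (Suc i) - tube_center m x a (Suc i)\<bar> \<le> 1")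
      case True
      have "(b (Y T (3*m) \<omega> i))\<^sup>2 / \<sigma>\<^sup>2 \<le> C" if "i < 3*m" for i
      proof -
        have "\<bar>tube_center m x a i\<bar> \<le> \<bar>x\<bar> + \<bar>a\<bar>" by (rule tube_center_simps(7)) (use that in auto)
        moreover have "\<bar>Y T (3*m) \<omega> i - tube_center m x a i\<bar> \<le> 1" using True that by blast
        ultimately have "Y T (3*m) \<omega> i \<in> {-K..K}" by (auto simp: K_def)
        then show ?thesis using C(2) abs_le_D1 by blast
      qed
      then have "(\<Sum>i<3*m. (b (Y T (3*m) \<omega> i))\<^sup>2 / \<sigma>\<^sup>2) \<le> (\<Sum>i<3*m. C)" by (intro sum_mono) simp
      then have "energy T (3*m) \<omega> \<le> T / real (3*m) * (\<Sum>i<3*m. C)"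
        unfolding energy_def using T by (intro mult_left_mono) auto
      also have "\<dots> \<le> T * C" using T C(1) by (cases "m = 0") auto
      finally show ?thesis using True by (simp add: f_def ennreal_leI)
    next
      case False
      then show ?thesis unfolding f_def by (subst if_not_P) simp_all
    qed
    show ?thesis
      by (rule nn_integral_limsup[where w="\<lambda>_. ennreal (exp (1/2 * (T * C)))"])
        (use bd in \<open>auto simp: emeasure_space_1\<close>)
  qed
  also have "\<dots> \<le> novikov_half M b \<sigma> X T"
    unfolding novikov_half_def
  proof (rule nn_integral_mono_AE)
    show "AE \<omega> in M. limsup (\<lambda>m. f m \<omega>) \<le> ennreal (exp (1/2 * (LBINT s:{0..T}. (b (X s \<omega>))\<^sup>2 / \<sigma>\<^sup>2)))"
      using AE_euler[OF T]
    proof eventually_elim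
      case (elim \<omega>)
      have lim: "filterlim (\<lambda>m::nat. 3*m) at_top sequentially"
        by (rule filterlim_at_top_mono[OF filterlim_ident]) simp
      have "(\<lambda>m. ennreal (exp (1/2 * energy T (3*m) \<omega>)))
          \<longlonglongrightarrow> ennreal (exp (1/2 * (LBINT s:{0..T}. (b (X s \<omega>))\<^sup>2 / \<sigma>\<^sup>2)))"
        using elim by (intro tendsto_intros tendsto_ennrealI filterlim_compose[OF _ lim]) auto
      then have "limsup (\<lambda>m. ennreal (exp (1/2 * energy T (3*m) \<omega>)))
          = ennreal (exp (1/2 * (LBINT s:{0..T}. (b (X s \<omega>))\<^sup>2 / \<sigma>\<^sup>2)))"
        by (simp add: lim_imp_Limsup)
      \<comment> \<open>Dropping the confinement to the tube can only increase the
        functional.\<close>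
      moreover have "limsup (\<lambda>m. f m \<omega>) \<le> limsup (\<lambda>m. ennreal (exp (1/2 * energy T (3*m) \<omega>)))"
        by (intro Limsup_mono always_eventually) (auto simp: f_def)
      ultimately show ?case by simp
    qed
  qed
  finally show ?thesis .
qed

text \<open>The integrand is nonnegative. Divergence at a short horizon, where small oscillation is
  likely, thus extends to every longer one.\<close>

lemma novikov_half_mono:
  assumes "T \<le> T'"
  shows "novikov_half M b \<sigma> X T \<le> novikov_half M b \<sigma> X T'"
  unfolding novikov_half_def
proof (rule nn_integral_mono_AE)
  show "AE \<omega> in M. ennreal (exp (1/2 * (LBINT s:{0..T}. (b (X s \<omega>))\<^sup>2 / \<sigma>\<^sup>2)))
    \<le> ennreal (exp (1/2 * (LBINT s:{0..T'}. (b (X s \<omega>))\<^sup>2 / \<sigma>\<^sup>2)))"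
    using AE_solution
  proof eventually_elim
    case (elim \<omega>)
    then have c: "continuous_on {0..} (\<lambda>t. X t \<omega>)" by simp
    have "set_integrable lborel {0..S} (\<lambda>s. (b (X s \<omega>))\<^sup>2 / \<sigma>\<^sup>2)" for S
      using continuous_integrand[OF c] by (rule borel_integrable_atLeastAtMost')
    then have "(LBINT s:{0..T}. (b (X s \<omega>))\<^sup>2 / \<sigma>\<^sup>2) \<le> (LBINT s:{0..T'}. (b (X s \<omega>))\<^sup>2 / \<sigma>\<^sup>2)"
      using assms unfolding set_lebesgue_integral_def set_integrable_def
      by (intro integral_mono) (auto simp: indicator_def)
    then show ?case by (intro ennreal_leI) simp
  qed
qed

text \<open>Travelling to \<open>a n\<close> and back costs an exponent of order
  \<open>(R n)\<^sup>2\<close>, while staying there earns \<open>\<kappa> n * T / 12\<close>. Since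
  \<open>\<kappa> n / (R n)\<^sup>2\<close> is unbounded, the gain exceeds the cost by any
  prescribed amount \<open>P\<close>.\<close>

lemma novikov_half_infinite:
  fixes R \<kappa> :: "nat \<Rightarrow> real"
  assumes T0: "T0 > 0" and R: "filterlim R at_top sequentially" and a: "\<And>n. \<bar>a n - \<theta>\<bar> = \<bar>R n\<bar>"
    and q: "\<And>n v. \<bar>v - a n\<bar> \<le> 1 \<Longrightarrow> \<kappa> n \<le> neg_slope b v"
    and \<kappa>: "filterlim (\<lambda>n. \<kappa> n / (R n)\<^sup>2) at_top sequentially"
  shows "novikov_half M b \<sigma> X T0 = \<infinity>"
proof -
  obtain T where T: "0 < T" "T \<le> T0" "\<And>n. n > 0 \<Longrightarrow> prob {\<omega> \<in> space M. small_oscillation T n \<omega>} \<ge> 3/4"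
    using small_oscillation_likely[OF T0] by blast
  have "continuous_on {x - 1..x + 1} L"
    using DERIV_isCont[OF L] by (simp add: continuous_at_imp_continuous_on)
  from compact_imp_bounded[OF compact_continuous_image[OF this compact_Icc]]
  obtain l where "\<forall>y\<in>{x - 1..x + 1}. \<bar>L y\<bar> \<le> l"
    unfolding bounded_pos by auto
  then have l: "- l \<le> L y" if "\<bar>y - x\<bar> \<le> 1" for y
  proof -
    have "y \<in> {x - 1..x + 1}" using that by (simp add: abs_le_iff)
    with \<open>\<forall>y\<in>{x - 1..x + 1}. \<bar>L y\<bar> \<le> l\<close> have "\<bar>L y\<bar> \<le> l" by blast
    then show ?thesis by linarith
  qed
  \<comment> \<open>Chosen so that the distance from \<open>x\<close> to \<open>a n\<close> is at
    most \<open>R n * D\<close> once \<open>R n \<ge> 1\<close>.\<close>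
  define D where "D = 1 + \<bar>\<theta> - x\<bar>"
  define c0 where "c0 = (- l - L x) / \<sigma>\<^sup>2"
  have big: "ennreal (1/2 * exp (c0 + P)) \<le> novikov_half M b \<sigma> X T" if P: "P \<ge> 0" for P
  proof -
    \<comment> \<open>With this ratio the gain is at least the bound
      \<open>12 * (R n * D)\<^sup>2 / (\<sigma>\<^sup>2 * T)\<close> on the cost plus
      \<open>P * (R n)\<^sup>2\<close>.\<close>
    define Q where "Q = 12 / T * (12 * D\<^sup>2 / (\<sigma>\<^sup>2 * T) + P)"
    have "\<forall>\<^sub>F n in sequentially. R n \<ge> 1 \<and> \<kappa> n / (R n)\<^sup>2 \<ge> Q"
      using R \<kappa> unfolding filterlim_at_top by (auto intro: eventually_conj)
    then obtain n where n: "R n \<ge> 1" "\<kappa> n / (R n)\<^sup>2 \<ge> Q"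
      by (auto simp: eventually_sequentially)
    have R2: "(R n)\<^sup>2 \<ge> 1" using n(1) by (simp add: one_le_power)
    have Q0: "Q \<ge> 0" using P T(1) by (simp add: Q_def)
    have \<kappa>n: "\<kappa> n \<ge> Q * (R n)\<^sup>2"
    proof -
      have "(R n)\<^sup>2 > 0" using R2 by linarith
      then show ?thesis using n(2) by (simp only: pos_le_divide_eq)
    qed
    then have \<kappa>0: "\<kappa> n \<ge> 0" using Q0 by (meson mult_nonneg_nonneg order_trans zero_le_power2)
    have "\<bar>a n - x\<bar> \<le> R n + \<bar>\<theta> - x\<bar>" using a[of n] n(1) by linarith
    also have "\<dots> \<le> R n * D" using n(1) mult_right_mono[of 1 "R n" "\<bar>\<theta> - x\<bar>"] by (simp add: D_def algebra_simps)
    finally have ax: "\<bar>a n - x\<bar> \<le> R n * D" .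
    have RD: "R n * D \<ge> 1" using n(1) mult_mono[of 1 "R n" 1 D] by (simp add: D_def)
    have "9 * \<bar>a n - x\<bar> + 3 * (a n - x)\<^sup>2 \<le> 12 * (R n * D)\<^sup>2"
    proof -
      have "(a n - x)\<^sup>2 \<le> (R n * D)\<^sup>2" by (rule abs_le_square_iff[THEN iffD1]) (use ax RD in simp)
      moreover have "R n * D \<le> (R n * D)\<^sup>2"
        using mult_left_mono[OF RD, of "R n * D"] RD by (simp add: power2_eq_square)
      moreover have "9 * t + 3 * u \<le> 12 * w" if "t \<le> v" "v \<le> w" "u \<le> w" for t u v w :: real
        using that by linarith
      ultimately show ?thesis using ax by blast
    qed
    then have "(9 * \<bar>a n - x\<bar> + 3 * (a n - x)\<^sup>2) / (\<sigma>\<^sup>2 * T) \<le> 12 * (R n * D)\<^sup>2 / (\<sigma>\<^sup>2 * T)"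
      using T(1) by (intro divide_right_mono) auto
    moreover have "\<kappa> n * T / 12 \<ge> Q * (R n)\<^sup>2 * T / 12" using \<kappa>n T(1) by simp
    moreover have "Q * (R n)\<^sup>2 * T / 12 = 12 * (R n * D)\<^sup>2 / (\<sigma>\<^sup>2 * T) + P * (R n)\<^sup>2"
      using T(1) by (simp add: Q_def power_mult_distrib field_simps)
    moreover have "P * (R n)\<^sup>2 \<ge> P" using P R2 mult_left_mono[of 1 "(R n)\<^sup>2" P] by simp
    ultimately have "c0 + P \<le> c0 - (9 * \<bar>a n - x\<bar> + 3 * (a n - x)\<^sup>2) / (\<sigma>\<^sup>2 * T) + \<kappa> n * T / 12" by linarith
    then have "ennreal (1/2 * exp (c0 + P)) \<le>
        ennreal (1/2 * exp (c0 - (9 * \<bar>a n - x\<bar> + 3 * (a n - x)\<^sup>2) / (\<sigma>\<^sup>2 * T) + \<kappa> n * T / 12))"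
      by (intro ennreal_leI) simp
    also have "\<dots> \<le> novikov_half M b \<sigma> X T"
      unfolding c0_def by (rule novikov_half_ge[OF T(1,3) \<kappa>0 l q])
    finally show ?thesis .
  qed
  have "novikov_half M b \<sigma> X T = \<infinity>"
  proof (rule ccontr)
    assume "novikov_half M b \<sigma> X T \<noteq> \<infinity>"
    then obtain r where r: "r \<ge> 0" "novikov_half M b \<sigma> X T = ennreal r"
      by (metis ennreal_cases infinity_ennreal_def)
    \<comment> \<open>Then \<open>c0 + P \<ge> 2 * r\<close>, and \<open>1 + u \<le> exp u\<close>
      pushes the lower bound above \<open>r\<close>.\<close>
    define P where "P = \<bar>2 * r - c0\<bar>"
    have "1/2 * exp (c0 + P) \<le> r" using big[of P] r by (simp add: P_def)
    moreover have "1 + (c0 + P) \<le> exp (c0 + P)" by (rule exp_ge_add_one_self)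
    ultimately show False using abs_ge_self[of "2 * r - c0"] unfolding P_def by linarith
  qed
  then show ?thesis using novikov_half_mono[OF T(2)] by (simp add: top_unique)
qed

end

section \<open>Window infima and the two halves of the dichotomy\<close>

text \<open>Boundedness from below makes the real infimum over a window a lower bound for the slope
  at each of its points.\<close>

lemma neg_slope_bdd_below: "b \<in> drift_class \<Longrightarrow> bdd_below (neg_slope b ` A)"
  using neg_slope_nonneg by (auto simp: bdd_below_def)

theorem theorem3p13:
  fixes M :: "'a measure" and W :: "real \<Rightarrow> 'a \<Rightarrow> real"
    and b :: "real \<Rightarrow> real" and \<sigma> \<theta> :: real
  assumes "standard_brownian_motion M W"
    and "\<sigma> > 0"
    and "b \<in> drift_class" and "b \<theta> = 0"
  shows "((\<lambda>y. neg_slope b (\<theta> + y)) \<in> o[at_infinity](\<lambda>y. y\<^sup>2) \<longrightarrow>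
            (\<forall>T>0. \<forall>x X. strong_solution M W b \<sigma> x X \<longrightarrow> novikov_half M b \<sigma> X T < \<infinity>)) \<and>
         (supercritical b \<longrightarrow>
            (\<forall>T>0. \<forall>x X. strong_solution M W b \<sigma> x X \<longrightarrow> novikov_half M b \<sigma> X T = \<infinity>))"
proof -
  obtain L where L: "\<And>y. (L has_real_derivative b y) (at y)" "\<And>y. L y \<le> L \<theta>"
    using drift_potential[OF assms(3,4)] by blast
  have sde: "sde M W X b L \<sigma> \<theta> x" if "strong_solution M W b \<sigma> x X" for x X
    using assms L that unfolding sde_def sde_axioms_def standard_brownian_motion_def by blast
  have eq: "equilibrium b = \<theta>" using assms(3,4) by (rule equilibrium_eqI)
  show ?thesis
  proof (intro conjI impI allI)
    fix T x :: real and X :: "real \<Rightarrow> 'a \<Rightarrow> real" assume "(\<lambda>y. neg_slope b (\<theta> + y)) \<in> o[at_infinity](\<lambda>y. y\<^sup>2)" "T > 0"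
      and X: "strong_solution M W b \<sigma> x X"
    then show "novikov_half M b \<sigma> X T < \<infinity>" by (intro sde.novikov_half_finite[OF sde[OF X]])
  next
    fix T x :: real and X :: "real \<Rightarrow> 'a \<Rightarrow> real" assume "supercritical b" and T: "T > 0" and X: "strong_solution M W b \<sigma> x X"
    then obtain R :: "nat \<Rightarrow> real" where R: "filterlim R at_top sequentially"
      and "filterlim (\<lambda>n. window_inf_pos b (R n) / (R n)\<^sup>2) at_top sequentially \<or>
         filterlim (\<lambda>n. window_inf_neg b (R n) / (R n)\<^sup>2) at_top sequentially"
      unfolding supercritical_def by blast
    then show "novikov_half M b \<sigma> X T = \<infinity>"
    proof (elim disjE)
      \<comment> \<open>The window is the interval of half-width one around
        \<open>\<theta> + R n\<close>, so its infimum serves as \<open>\<kappa>\<close> with this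
        point as the place to visit.\<close>
      assume w: "filterlim (\<lambda>n. window_inf_pos b (R n) / (R n)\<^sup>2) at_top sequentially"
      show ?thesis
      proof (rule sde.novikov_half_infinite[OF sde[OF X] T R _ _ w, where a="\<lambda>n. \<theta> + R n"])
        fix n v assume "\<bar>v - (\<theta> + R n)\<bar> \<le> 1"
        then show "window_inf_pos b (R n) \<le> neg_slope b v"
          unfolding window_inf_pos_def eq
          by (intro cINF_lower neg_slope_bdd_below assms) (simp add: algebra_simps)
      qed simp
    next
      \<comment> \<open>The mirror case: the window is centred at
        \<open>\<theta> - R n\<close>.\<close>
      assume w: "filterlim (\<lambda>n. window_inf_neg b (R n) / (R n)\<^sup>2) at_top sequentially"
      show ?thesis
      proof (rule sde.novikov_half_infinite[OF sde[OF X] T R _ _ w, where a="\<lambda>n. \<theta> - R n"])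
        fix n v assume "\<bar>v - (\<theta> - R n)\<bar> \<le> 1"
        then show "window_inf_neg b (R n) \<le> neg_slope b v"
          unfolding window_inf_neg_def eq
          by (intro cINF_lower neg_slope_bdd_below assms) (simp add: abs_le_iff algebra_simps)
      qed simp
    qed
  qed
qed

end
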